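(* Consider F-TaS as described in the context, on the $K$-armed unit-variance Gaussian bandit with $\theta\in\Theta$, with either pre-specified fairness rates $p\in[0,1]^K$ or continuous $\theta$-dependent rates $p:\mathbb{R}^K\to[0,1]^K$ (in which case $p=p(\theta)$ below). Then for every $\delta\in(0,1/2)$, $\mathbb{E}_\theta[\tau_\delta]<\infty$, and: (1) $\mathbb{P}_\theta\left(\limsup_{\delta\to0}\frac{\tau_\delta}{\log(1/\delta)}\le T^\star_p(\theta)\right)=1$; (2) $\limsup_{\delta\to0}\frac{\mathbb{E}_\theta[\tau_\delta]}{\log(1/\delta)}\le T^\star_p(\theta)$.
   Context: Bandit model: arms $[K]$, unknown $\theta\in\Theta:=\{\theta\in\mathbb{R}^K:\arg\max_a\theta_a\text{ unique}\}$; at round $t$ the learner picks $a_t$ and observes $r_t\sim\mathcal N(\theta_{a_t},1)$ independently given $a_t$. $a^\star=\arg\max_a\theta_a$, $\Delta_a=\theta_{a^\star}-\theta_a$, $N_a(t)=\sum_{s\le t}\mathbf1\{a_s=a\}$, $\hat\theta_a(t)$ the empirical mean of arm $a$ after $t$ rounds. Fairness rates: pre-specified $p\in[0,1]^K$ with $p_{\rm sum}=\sum_ap_a\le1$, or continuous $p:\mathbb{R}^K\to[0,1]^K$ with $\sum_ap_a(\cdot)\le1$. $\Sigma_p=\{w\in[0,1]^K:w\ge p,\sum_aw_a=1\}$; $T^\star_p(\theta)=2\inf_{w\in\Sigma_p}\max_{a\ne a^\star}(w_a^{-1}+w_{a^\star}^{-1})/\Delta_a^2$. For a parameter $\lambda$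 with unique best arm $a^\star_\lambda$ and gaps $\Delta_a(\lambda)$, $w^\star_p(\lambda)\in\arg\min_{w\in\Sigma_p}\max_{a\ne a^\star_\lambda}(w_a^{-1}+w_{a^\star_\lambda}^{-1})/\Delta_a(\lambda)^2$ (with $p=p(\lambda)$ in the $\theta$-dependent case). F-TaS: $\epsilon_t=1/(2\sqrt t)$; constant policy $\pi_c$: pre-specified case with $K_0=|\{a:p_a=0\}|$: if $K_0=0$, $\pi_{c,a}=p_a+(1-p_{\rm sum})/K$; otherwise $\pi_{c,a}=p_a$ if $p_a>0$, $(1-p_{\rm sum})/K_0$ if $p_a=0$; $\theta$-dependent case: $\pi_{c,a}=1/K$. Round $t$: $\pi(t)=(1-\epsilon_t)w^\star_p(\hat\theta)+\epsilon_t\pi_c$ with $\hat\theta$ the current empirical means (fixed convention when undefined), $a_t\sim\pi(t)$. Stopping time $\tau_\delta=\inf\{t:Z(t)\ge\beta(\delta,t)\}$, where with $\hat a_t=\arg\max_a\hat\theta_a(t)$, $\Delta_a(t)=\hat\theta_{\hat a_t}(t)-\hat\theta_a(t)$: $Z(t)=\min_{a\ne\hat a_t}\Delta_a(t)^2/(2(N_a(t)^{-1}+N_{\hat a_t}(t)^{-1}))$ and $\beta(\delta,t)=3\sum_a\log(1+\log N_a(t))+K\mathcal C_{\exp}(\log(1/\delta)/K)$, with $\mathcal C_{\exp}(x)=2\tilde h_{3/2}((h^{-1}(1+x)+\ln(2\zeta(2)))/2)$, $h(u)=u-\ln u$ ($u\ge1$), $\tilde h_z(x)=e^{1/h^{-1}(x)}h^{-1}(x)$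 if $x\ge h^{-1}(1/\ln z)$ and $z(x-\ln\ln z)$ otherwise (Kaufmann–Koolen 2021, Thm. 7). Output $\arg\max_a\hat\theta_a(\tau_\delta)$.
   Formalization: For pre-specified rates it is additionally assumed that p_sum < 1 or all p_a > 0 (otherwise an arm with p_a = 0 is never sampled and the expected stopping time is infinite), and K ≥ 2 is assumed. *)

theory Defs
  imports "HOL-Probability.Probability"
begin

text \<open>Arms are the elements of a finite linearly ordered type 'k (the linear order is only
used to turn a uniform random number into a draw from a probability vector);
K = CARD('k). Parameters theta live in real^'k.\<close>

definition uniq_best :: "real^'k \<Rightarrow> bool" where
  "uniq_best lam \<longleftrightarrow> (\<exists>a. \<forall>b. b \<noteq> a \<longrightarrow> lam$b < lam$a)"

definition best_arm :: "real^'k \<Rightarrow> 'k" where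
  "best_arm lam = (SOME a. \<forall>b. lam$b \<le> lam$a)"

definition gap :: "real^'k \<Rightarrow> 'k \<Rightarrow> real" where
  "gap lam a = lam$(best_arm lam) - lam$a"

datatype 'k fairness = Prespec "real^'k" | Dep "real^'k \<Rightarrow> real^'k"

fun rate :: "'k fairness \<Rightarrow> real^'k \<Rightarrow> real^'k" where
  "rate (Prespec p) lam = p"
| "rate (Dep p) lam = p lam"

definition valid_rate :: "real^'k \<Rightarrow> bool" where
  "valid_rate p \<longleftrightarrow> (\<forall>a. 0 \<le> p$a \<and> p$a \<le> 1) \<and> (\<Sum>a\<in>UNIV. p$a) \<le> 1"

fun valid_fairness :: "('k::finite) fairness \<Rightarrow> bool" where
  "valid_fairness (Prespec p) \<longleftrightarrow> valid_rate p"
| "valid_fairness (Dep p) \<longleftrightarrow> continuous_on UNIV p \<and> (\<forall>x. valid_rate (p x))"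

fun pic :: "('k::finite) fairness \<Rightarrow> real^'k" where
  "pic (Prespec p) =
     (let K0 = card {a. p$a = 0}; ps = (\<Sum>a\<in>UNIV. p$a) in
      if K0 = 0 then (\<chi> a. p$a + (1 - ps) / real CARD('k))
      else (\<chi> a. if p$a > 0 then p$a else (1 - ps) / real K0))"
| "pic (Dep p) = (\<chi> a. 1 / real CARD('k))"

definition Sigma_p :: "real^'k \<Rightarrow> (real^'k) set" where
  "Sigma_p p = {w. (\<forall>a. p$a \<le> w$a \<and> 0 \<le> w$a \<and> w$a \<le> 1) \<and> (\<Sum>a\<in>UNIV. w$a) = 1}"

definition einv :: "real \<Rightarrow> ereal" where
  "einv x = (if x = 0 then \<infinity> else ereal (1 / x))"

definition obj :: "real^'k \<Rightarrow> real^'k \<Rightarrow> ereal" where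
  "obj lam w = Max ((\<lambda>a. (einv (w$a) + einv (w$(best_arm lam))) / ereal ((gap lam a)\<^sup>2))
                     ` {a. a \<noteq> best_arm lam})"

definition Tstar :: "real^'k \<Rightarrow> real^'k \<Rightarrow> ereal" where
  "Tstar p theta = 2 * (INF w\<in>Sigma_p p. obj theta w)"

definition wstar :: "('k::finite) fairness \<Rightarrow> real^'k \<Rightarrow> real^'k" where
  "wstar F lam =
     (if uniq_best lam then
        (SOME w. w \<in> Sigma_p (rate F lam) \<and> (\<forall>v\<in>Sigma_p (rate F lam). obj lam w \<le> obj lam v))
      else pic F)"

definition eps :: "nat \<Rightarrow> real" where
  "eps t = 1 / (2 * sqrt (real t))"

definition policy :: "('k::finite) fairness \<Rightarrow> nat \<Rightarrow> real^'k \<Rightarrow> real^'k" where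
  "policy F t th = (1 - eps t) *\<^sub>R wstar F th + eps t *\<^sub>R pic F"

text \<open>Drawing an arm from probability vector pi with a uniform number u in [0,1]
(inverse CDF along the linear order of arms).\<close>
definition sample :: "real^('k::{finite,linorder}) \<Rightarrow> real \<Rightarrow> 'k" where
  "sample q u = (if \<exists>a. u < (\<Sum>b\<in>{..a}. q$b) then (LEAST a. u < (\<Sum>b\<in>{..a}. q$b))
                  else Max UNIV)"

text \<open>Probability space: at every round t an independent pair (U_t, Y_t) with
U_t uniform on [0,1] and Y_t a vector of independent N(theta_a, 1) rewards; the reward
observed at round t is Y_t(a_t). Rounds are t = 1, 2, ...; coordinate 0 is unused.\<close>
type_synonym 'k outcome = "nat \<Rightarrow> real \<times> ('k \<Rightarrow> real)"

definition round_meas :: "real^'k \<Rightarrow> (real \<times> ('k \<Rightarrow> real)) measure" where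
  "round_meas theta = uniform_measure lborel {0..1::real}
      \<Otimes>\<^sub>M (\<Pi>\<^sub>M a\<in>UNIV. density lborel (normal_density (theta$a) 1))"

definition traj_meas :: "real^'k \<Rightarrow> 'k outcome measure" where
  "traj_meas theta = (\<Pi>\<^sub>M t\<in>UNIV. round_meas theta)"

text \<open>Empirical means (convention: 0 for unpulled arms).\<close>
definition emp_mean :: "('k \<Rightarrow> nat) \<times> ('k \<Rightarrow> real) \<Rightarrow> real^'k" where
  "emp_mean st = (\<chi> a. snd st a / real (fst st a))"

fun state :: "('k::{finite,linorder}) fairness \<Rightarrow> 'k outcome \<Rightarrow> nat \<Rightarrow> ('k \<Rightarrow> nat) \<times> ('k \<Rightarrow> real)" where
  "state F \<omega> 0 = (\<lambda>a. 0, \<lambda>a. 0)"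
| "state F \<omega> (Suc t) =
     (let st = state F \<omega> t;
          a = sample (policy F (Suc t) (emp_mean st)) (fst (\<omega> (Suc t)));
          r = snd (\<omega> (Suc t)) a
      in ((fst st)(a := fst st a + 1), (snd st)(a := snd st a + r)))"

definition Zstat :: "('k::finite \<Rightarrow> nat) \<times> ('k \<Rightarrow> real) \<Rightarrow> real" where
  "Zstat st = (let th = emp_mean st; ah = best_arm th; N = fst st in
     Min ((\<lambda>a. (th$ah - th$a)\<^sup>2 / (2 * (1 / real (N a) + 1 / real (N ah)))) ` {a. a \<noteq> ah}))"

definition hfun :: "real \<Rightarrow> real" where
  "hfun u = u - ln u"

definition hinv :: "real \<Rightarrow> real" where
  "hinv x = (THE u. 1 \<le> u \<and> hfun u = x)"

definition htilde :: "real \<Rightarrow> real \<Rightarrow> real" where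
  "htilde z x = (if hinv (1 / ln z) \<le> x then exp (1 / hinv x) * hinv x
                 else z * (x - ln (ln z)))"

text \<open>zeta(2) = pi^2/6.\<close>
definition Cexp :: "real \<Rightarrow> real" where
  "Cexp x = 2 * htilde (3/2) ((hinv (1 + x) + ln (2 * (pi\<^sup>2 / 6))) / 2)"

definition thresh :: "real \<Rightarrow> ('k::finite \<Rightarrow> nat) \<Rightarrow> real" where
  "thresh \<delta> N = 3 * (\<Sum>a\<in>UNIV. ln (1 + ln (real (N a))))
                 + real CARD('k) * Cexp (ln (1 / \<delta>) / real CARD('k))"

definition stop_cond :: "('k::{finite,linorder}) fairness \<Rightarrow> real \<Rightarrow> 'k outcome \<Rightarrow> nat \<Rightarrow> bool" where
  "stop_cond F \<delta> \<omega> t = (let st = state F \<omega> t in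
     (\<forall>a. 1 \<le> fst st a) \<and> thresh \<delta> (fst st) \<le> Zstat st)"

definition tau :: "('k::{finite,linorder}) fairness \<Rightarrow> real \<Rightarrow> 'k outcome \<Rightarrow> enat" where
  "tau F \<delta> \<omega> = (if \<exists>t. stop_cond F \<delta> \<omega> t then enat (LEAST t. stop_cond F \<delta> \<omega> t) else \<infinity>)"

end

theory Submission
  imports Defs "HOL-Real_Asymp.Real_Asymp"
begin

text \<open>Everything follows from one integrable random time $M$: after round $M$ every arm $a$ has
  been drawn at least $c\sqrt t$ times, the empirical means are $e$-close to $\theta$, and $N_a(t)/t$ is at
  least $w^\star_a - e$. Then $Z(t)$ is at least $t/V$ for any prescribed $V > T^\star$, while the threshold is
  $\log(1/\delta)(1+o(1)) + O(\log\log t)$, so $\tau_\delta \le M + V\log(1/\delta)(1+o(1)) + O(1)$,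
  which gives the almost sure and the expectation bound at once. When $T^\star = \infty$ only finiteness
  of the expectation has content, and $Z(t) \ge c'\sqrt t$ suffices for it.

  The optimal allocation $w^\star$ is unique, hence a continuous function of the parameter; this
  makes the sampling rule measurable and lets it track $w^\star_p(\theta)$. Concentration
  comes from two exponential supermartingales, one for the counts $N_a$ against the sum of the drawing
  probabilities and one for the centred rewards, whose tails are $O(e^{-k\sqrt t})$.\<close>

section \<open>The optimal allocation\<close>

text \<open>Three obstacles shape the study of the allocation: the objective is infinite where a
  weight vanishes, the feasible polytope moves with the parameter, and the best arm jumps at ties.
  They are met by passing to the reciprocal objective, by transporting competitors between
  neighbouring polytopes, and by asking for continuity only on the open set without ties. Rates that
  sum to one need separate treatment throughout, since the polytope is then a single point and the
  optimal value may be infinite. That the random time does not depend on \<delta> matters: the limit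
  runs over uncountably many \<delta>, so the exceptional null set has to be fixed beforehand. The
  rate sqrt t comes from \<open>eps\<close>, whose partial sums are of that order: large enough to
  force sqrt t draws of every arm and to make t * exp(- k * sqrt t) summable, yet negligible against
  the t draws that have to follow the optimal weights.\<close>

lemma best_armI:
  fixes lam :: "real^'k"
  assumes "\<And>b. b \<noteq> a \<Longrightarrow> lam$b < lam$a"
  shows "best_arm lam = a"
  unfolding best_arm_def
proof (rule some_equality)
  show "\<forall>b. lam$b \<le> lam$a" using assms by (metis less_eq_real_def)
  show "c = a" if "\<forall>b. lam$b \<le> lam$c" for c
    using that assms by (metis not_less)
qed

lemma best_arm_greater:
  assumes "uniq_best lam" "b \<noteq> best_arm lam"
  shows "lam$b < lam$(best_arm lam)"
  using assms best_armI unfolding uniq_best_def by metis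

lemma gap_pos:
  assumes "uniq_best lam" "b \<noteq> best_arm lam"
  shows "0 < gap lam b"
  using best_arm_greater[OF assms] by (simp add: gap_def)

lemma open_best_arm: "open {lam :: real^'k::finite. \<forall>b. b \<noteq> a \<longrightarrow> lam$b < lam$a}"
proof -
  have "{lam :: real^'k. \<forall>b. b \<noteq> a \<longrightarrow> lam$b < lam$a} = (\<Inter>b\<in>UNIV-{a}. {lam. lam$b < lam$a})"
    by auto
  also have "open \<dots>"
    by (intro open_INT ballI open_Collect_less continuous_intros) auto
  finally show ?thesis .
qed

lemma open_uniq_best: "open {lam :: real^'k::finite. uniq_best lam}"
proof -
  have "{lam :: real^'k. uniq_best lam} = (\<Union>a. {lam. \<forall>b. b \<noteq> a \<longrightarrow> lam$b < lam$a})"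
    by (auto simp: uniq_best_def)
  then show ?thesis using open_best_arm by auto
qed

text \<open>Freezes the index set of the minimum in \<open>util\<close> along a convergent family;
  the members of the family may themselves have ties early on.\<close>

lemma eventually_best_arm:
  fixes lam :: "real^'k::finite"
  assumes "uniq_best lam" "(X \<longlongrightarrow> lam) G"
  shows "\<forall>\<^sub>F n in G. best_arm (X n) = best_arm lam"
proof -
  have "\<forall>\<^sub>F n in G. X n \<in> {l. \<forall>b. b \<noteq> best_arm lam \<longrightarrow> l$b < l$(best_arm lam)}"
    using assms(2) open_best_arm best_arm_greater[OF assms(1)]
    by (intro topological_tendstoD) auto
  then show ?thesis by eventually_elim (auto intro: best_armI)
qed

section \<open>Half the harmonic mean of two weights\<close>

text \<open>With $0/0 = 0$ this is the continuous extension of $1/(1/x + 1/y)$ to the closed quadrant.\<close>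

definition hmean :: "real \<Rightarrow> real \<Rightarrow> real" where
  "hmean x y = x * y / (x + y)"

lemma hmean_nonneg: "0 \<le> x \<Longrightarrow> 0 \<le> y \<Longrightarrow> 0 \<le> hmean x y"
  by (simp add: hmean_def)

lemma hmean_pos: "0 < x \<Longrightarrow> 0 < y \<Longrightarrow> 0 < hmean x y"
  by (simp add: hmean_def add_pos_pos)

lemma hmean_posD:
  assumes "0 \<le> x" "0 \<le> y" "0 < hmean x y" shows "0 < x" "0 < y"
  using assms by (auto simp: hmean_def order_le_less)

lemma hmean_inverse: "0 < x \<Longrightarrow> 0 < y \<Longrightarrow> hmean x y = 1 / (1 / x + 1 / y)"
  by (simp add: hmean_def field_simps)

lemma less_hmean_iff:
  assumes "0 < x" "0 < y" "0 < r"
  shows "r < hmean x y \<longleftrightarrow> 1 / x + 1 / y < 1 / r"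
proof -
  have "0 < 1 / x + 1 / y" using assms by (simp add: add_pos_pos)
  then show ?thesis using assms
    by (simp only: hmean_inverse less_divide_eq) (simp add: mult.commute)
qed

lemma le_hmean_iff:
  assumes "0 < x" "0 < y" "0 < r"
  shows "r \<le> hmean x y \<longleftrightarrow> 1 / x + 1 / y \<le> 1 / r"
proof -
  have "0 < 1 / x + 1 / y" using assms by (simp add: add_pos_pos)
  then show ?thesis using assms
    by (simp only: hmean_inverse le_divide_eq) (simp add: mult.commute)
qed

lemma hmean_strict_mono:
  assumes "0 < x" "0 < y" "x < x'" "y < y'"
  shows "hmean x y < hmean x' y'"
proof -
  have "1 / x' + 1 / y' < 1 / x + 1 / y"
    using assms by (intro add_strict_mono divide_strict_left_mono) auto
  then show ?thesis using assms hmean_pos[of x y]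
    by (subst less_hmean_iff) (auto simp: hmean_inverse)
qed

lemma inverse_midpoint:
  assumes "0 < (x::real)" "0 < y"
  shows "1 / ((x + y) / 2) \<le> (1 / x + 1 / y) / 2"
    and "x \<noteq> y \<Longrightarrow> 1 / ((x + y) / 2) < (1 / x + 1 / y) / 2"
proof -
  have e: "1 / ((x + y) / 2) = 2 / (x + y)" "(1 / x + 1 / y) / 2 = (x + y) / (2 * (x * y))"
    using assms by (simp_all add: add_frac_eq mult.commute add.commute)
  have s: "(x + y)\<^sup>2 = 4 * (x * y) + (x - y)\<^sup>2" by (simp add: power2_eq_square algebra_simps)
  have xy: "0 < x * y" "0 < x + y" using assms by auto
  show "1 / ((x + y) / 2) \<le> (1 / x + 1 / y) / 2"
    unfolding e using xy s zero_le_power2[of "x - y"]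
    by (simp add: pos_divide_le_eq pos_le_divide_eq power2_eq_square)
  show "1 / ((x + y) / 2) < (1 / x + 1 / y) / 2" if "x \<noteq> y"
  proof -
    have "0 < (x - y)\<^sup>2" using that by simp
    then have "2 * (2 * (x * y)) < (x + y) * (x + y)" using s by (simp add: power2_eq_square)
    then show ?thesis unfolding e using xy by (simp add: pos_divide_less_eq pos_less_divide_eq)
  qed
qed

text \<open>Only the origin is delicate, where the quotient is 0/0: there \<open>hmean\<close> is
  squeezed between 0 and its first argument. Elsewhere the denominator has a nonzero limit.\<close>

lemma tendsto_hmean:
  assumes "(f \<longlongrightarrow> x) G" "(g \<longlongrightarrow> y) G" "0 \<le> x" "0 \<le> y"
    and "\<forall>\<^sub>F n in G. 0 \<le> f n" "\<forall>\<^sub>F n in G. 0 \<le> g n"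
  shows "((\<lambda>n. hmean (f n) (g n)) \<longlongrightarrow> hmean x y) G"
proof (cases "x + y = 0")
  case True
  then have xy: "x = 0" "y = 0" using assms by auto
  have upper: "\<forall>\<^sub>F n in G. hmean (f n) (g n) \<le> f n"
    using assms(5,6)
  proof eventually_elim
    case (elim n)
    show ?case
    proof (cases "f n + g n = 0")
      case False
      then have "0 < f n + g n" using elim by linarith
      then show ?thesis using elim by (simp add: hmean_def pos_divide_le_eq distrib_left)
    qed (use elim in \<open>simp add: hmean_def\<close>)
  qed
  have lower: "\<forall>\<^sub>F n in G. 0 \<le> hmean (f n) (g n)"
    using assms(5,6) by eventually_elim (simp add: hmean_nonneg)
  have "(f \<longlongrightarrow> 0) G" using assms(1) xy by simp
  from tendsto_sandwich[OF lower upper tendsto_const this]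
  have "((\<lambda>n. hmean (f n) (g n)) \<longlongrightarrow> 0) G" .
  then show ?thesis by (simp add: xy hmean_def)
next
  case False
  then show ?thesis unfolding hmean_def by (intro tendsto_intros assms)
qed

section \<open>The reciprocal objective\<close>

text \<open>The reciprocal of the objective: real-valued and continuous up to the boundary of the simplex,
  where the objective itself is infinite.\<close>

definition util :: "real^'k \<Rightarrow> real^'k \<Rightarrow> real" where
  "util lam w = Min ((\<lambda>a. (gap lam a)\<^sup>2 * hmean (w$a) (w$(best_arm lam))) ` {a. a \<noteq> best_arm lam})"

lemma einv_le_iff: "0 \<le> x \<Longrightarrow> 0 \<le> y \<Longrightarrow> einv x \<le> einv y \<longleftrightarrow> y \<le> x"
  by (auto simp: einv_def divide_le_eq le_divide_eq)

text \<open>The reason for working with \<open>hmean\<close>: the identity survives on the boundary,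
  where a vanishing weight makes both sides infinite.\<close>

lemma einv_hmean:
  assumes "0 \<le> x" "0 \<le> y" "0 < g"
  shows "(einv x + einv y) / ereal (g\<^sup>2) = einv (g\<^sup>2 * hmean x y)"
proof (cases "x = 0 \<or> y = 0")
  case True
  then have "einv x = \<infinity> \<or> einv y = \<infinity>" by (auto simp: einv_def)
  then have "einv x + einv y = \<infinity>" by auto
  moreover have "hmean x y = 0" using True by (auto simp: hmean_def)
  moreover have "0 < ereal (g\<^sup>2)" using assms by simp
  ultimately show ?thesis by (simp only: mult_zero_right) (simp add: einv_def)
next
  case False
  then have "0 < x" "0 < y" "0 < hmean x y" using assms hmean_pos by auto
  then show ?thesis using assms
    by (simp add: einv_def hmean_inverse)
qed

text \<open>The parameter \<open>arms\<close> carries no data, it only names the type of arms.\<close>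

locale several_arms =
  fixes arms :: "'k::finite itself"
  assumes K2: "card (UNIV :: 'k set) \<ge> 2"
begin

lemma other_arm: "\<exists>a. a \<noteq> (b::'k)"
proof (rule ccontr)
  assume "\<not> ?thesis"
  then have "UNIV = {b}" by auto
  then show False using K2 by (metis One_nat_def card.empty card_insert_disjoint empty_iff finite.emptyI not_less_eq_eq numeral_2_eq_2 order_refl)
qed

lemma other_arms: "finite {a. a \<noteq> (b::'k)}" "{a. a \<noteq> (b::'k)} \<noteq> {}"
  using other_arm by auto

lemma less_util_iff: "V < util lam w \<longleftrightarrow>
    (\<forall>a::'k. a \<noteq> best_arm lam \<longrightarrow> V < (gap lam a)\<^sup>2 * hmean (w$a) (w$(best_arm lam)))"
  unfolding util_def using other_arms by (subst Min_gr_iff) auto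

lemma le_util_iff: "V \<le> util lam w \<longleftrightarrow>
    (\<forall>a::'k. a \<noteq> best_arm lam \<longrightarrow> V \<le> (gap lam a)\<^sup>2 * hmean (w$a) (w$(best_arm lam)))"
  unfolding util_def using other_arms by (subst Min_ge_iff) auto

text \<open>\<open>einv\<close> is decreasing on the nonnegative reals, so the largest reciprocal is
  the reciprocal of the smallest term, also when that term is 0.\<close>

lemma obj_eq_einv_util:
  fixes lam :: "real^'k"
  assumes "uniq_best lam" "\<And>a. 0 \<le> w$a"
  shows "obj lam w = einv (util lam w)"
proof -
  define b where "b = best_arm lam"
  define h where "h a = (gap lam a)\<^sup>2 * hmean (w$a) (w$b)" for a
  have h: "0 \<le> h a" for a using assms(2) by (simp add: h_def hmean_nonneg)
  have "obj lam w = Max ((\<lambda>a. einv (h a)) ` {a. a \<noteq> b})"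
    unfolding obj_def b_def[symmetric] h_def
    using einv_hmean[OF assms(2) assms(2) gap_pos[OF assms(1)]] 
    by (intro arg_cong[where f=Max] image_cong) (auto simp: b_def)
  also have "\<dots> = einv (Min (h ` {a. a \<noteq> b}))"
  proof (rule Max_eqI)
    have "Min (h ` {a. a \<noteq> b}) \<in> h ` {a. a \<noteq> b}"
      using other_arms by (intro Min_in) auto
    then show "einv (Min (h ` {a. a \<noteq> b})) \<in> (\<lambda>a. einv (h a)) ` {a. a \<noteq> b}"
      by auto
    show "y \<le> einv (Min (h ` {a. a \<noteq> b}))" if "y \<in> (\<lambda>a. einv (h a)) ` {a. a \<noteq> b}" for y
    proof -
      obtain a where a: "y = einv (h a)" "a \<noteq> b" using \<open>y \<in> _\<close> by auto
      have "Min (h ` {a. a \<noteq> b}) \<le> h a" using a other_arms by (intro Min_le) auto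
      moreover have "0 \<le> Min (h ` {a. a \<noteq> b})"
        using other_arms h by (subst Min_ge_iff) auto
      ultimately show ?thesis using a h by (simp add: einv_le_iff)
    qed
  qed (use other_arms in auto)
  also have "Min (h ` {a. a \<noteq> b}) = util lam w"
    by (simp add: util_def h_def b_def)
  finally show ?thesis .
qed

lemma util_nonneg: "(\<And>a::'k. 0 \<le> w$a) \<Longrightarrow> 0 \<le> util lam w"
  by (simp add: le_util_iff hmean_nonneg)

lemma obj_le_iff:
  fixes lam :: "real^'k"
  assumes "uniq_best lam" "\<And>a. 0 \<le> w$a" "\<And>a. 0 \<le> v$a"
  shows "obj lam w \<le> obj lam v \<longleftrightarrow> util lam v \<le> util lam w"
  using assms by (simp add: obj_eq_einv_util einv_le_iff util_nonneg)

text \<open>Every term contains the weight of the best arm and each other arm has a term of its own.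
  A second arm is what guarantees a term that sees the best arm at all.\<close>

lemma util_pos_iff:
  fixes lam :: "real^'k"
  assumes "uniq_best lam" "\<And>a. 0 \<le> w$a"
  shows "0 < util lam w \<longleftrightarrow> (\<forall>a. 0 < w$a)"
proof
  assume u: "0 < util lam w"
  show "\<forall>a. 0 < w$a"
  proof
    fix a
    obtain c where "c \<noteq> best_arm lam" "a = best_arm lam \<or> a = c"
      using other_arm by metis
    moreover from this have "0 < hmean (w$c) (w$(best_arm lam))"
      using u gap_pos[OF assms(1)] by (simp add: less_util_iff zero_less_mult_iff)
    ultimately show "0 < w$a" using hmean_posD assms(2) by metis
  qed
next
  assume "\<forall>a. 0 < w$a"
  then show "0 < util lam w" unfolding less_util_iff
    using gap_pos[OF assms(1)] hmean_pos by (metis zero_less_power mult_pos_pos)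
qed

lemma tendsto_util:
  fixes lam :: "real^'k"
  assumes "uniq_best lam" "(X \<longlongrightarrow> lam) G" "(W \<longlongrightarrow> w) G"
    and "\<And>a. 0 \<le> w$a" "\<And>n a. 0 \<le> W n$a"
  shows "((\<lambda>n. util (X n) (W n)) \<longlongrightarrow> util lam w) G"
proof -
  define b where "b = best_arm lam"
  \<comment> \<open>The best arm is that of the limit, not that of \<open>l\<close>; along the
    family the two agree only eventually, which the last step repairs.\<close>
  define h where "h l v a = (l$b - l$a)\<^sup>2 * hmean (v$a) (v$b)" for l v :: "real^'k" and a
  have h: "((\<lambda>n. h (X n) (W n) a) \<longlongrightarrow> h lam w a) G" for a
    unfolding h_def using assms
    by (intro tendsto_mult[OF tendsto_power[OF tendsto_diff] tendsto_hmean] tendsto_vec_nth always_eventually allI)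
  have 1: "((\<lambda>n. Min (h (X n) (W n) ` {a. a \<noteq> b})) \<longlongrightarrow> Min (h lam w ` {a. a \<noteq> b})) G"
  proof (rule order_tendstoI)
    fix r assume "r < Min (h lam w ` {a. a \<noteq> b})"
    then have "\<forall>a\<in>{a. a \<noteq> b}. r < h lam w a"
      using other_arms by (subst (asm) Min_gr_iff) auto
    then have "\<forall>a\<in>{a. a \<noteq> b}. \<forall>\<^sub>F n in G. r < h (X n) (W n) a"
      using order_tendstoD(1)[OF h] by blast
    then have "\<forall>\<^sub>F n in G. \<forall>a\<in>{a. a \<noteq> b}. r < h (X n) (W n) a"
      using other_arms by (intro eventually_ball_finite) auto
    then show "\<forall>\<^sub>F n in G. r < Min (h (X n) (W n) ` {a. a \<noteq> b})"
      by eventually_elim (use other_arms in \<open>subst Min_gr_iff, auto\<close>)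
  next
    fix r assume "Min (h lam w ` {a. a \<noteq> b}) < r"
    then obtain a where a: "a \<noteq> b" "h lam w a < r"
      using other_arms by (subst (asm) Min_less_iff) auto
    have "\<forall>\<^sub>F n in G. h (X n) (W n) a < r" using order_tendstoD(2)[OF h] a by auto
    then show "\<forall>\<^sub>F n in G. Min (h (X n) (W n) ` {a. a \<noteq> b}) < r"
      by eventually_elim (use other_arms a in \<open>subst Min_less_iff, auto\<close>)
  qed
  have 2: "Min (h lam w ` {a. a \<noteq> b}) = util lam w"
    by (simp add: util_def h_def b_def gap_def)
  have 3: "\<forall>\<^sub>F n in G. Min (h (X n) (W n) ` {a. a \<noteq> b}) = util (X n) (W n)"
    using eventually_best_arm[OF assms(1,2)]
    by eventually_elim (simp add: util_def h_def b_def gap_def)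
  show ?thesis using Lim_transform_eventually[OF 1 3] by (simp only: 2)
qed

section \<open>The polytope of feasible weights and its unique optimum\<close>

lemma Sigma_p_nonneg: "w \<in> Sigma_p p \<Longrightarrow> 0 \<le> w$a"
  by (simp add: Sigma_p_def)

lemma Sigma_pI:
  fixes p :: "real^'k"
  assumes "\<And>a. p$a \<le> w$a" "\<And>a. 0 \<le> w$a" "(\<Sum>a\<in>UNIV. w$a) = 1"
  shows "w \<in> Sigma_p p"
proof -
  have "w$a \<le> 1" for a
    using member_le_sum[of a UNIV "\<lambda>a. w$a"] assms by simp
  then show ?thesis using assms by (simp add: Sigma_p_def)
qed

text \<open>The degenerate case: without mass left to distribute the feasible point is forced, and
  no perturbation argument is available.\<close>

lemma Sigma_p_eq_rate:
  fixes p :: "real^'k"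
  assumes "w \<in> Sigma_p p" "(\<Sum>a\<in>UNIV. p$a) = 1"
  shows "w = p"
proof (rule ccontr)
  assume "w \<noteq> p"
  then obtain a where "p$a < w$a"
    using assms(1) by (force simp: Sigma_p_def vec_eq_iff order_le_less)
  then have "(\<Sum>a\<in>UNIV. p$a) < (\<Sum>a\<in>UNIV. w$a)"
    using assms(1) by (intro sum_strict_mono_ex1) (auto simp: Sigma_p_def)
  then show False using assms by (simp add: Sigma_p_def)
qed

text \<open>Spreading the missing mass evenly raises all coordinates at once. It yields feasible
  points, points of full support, and the strict improvement needed for uniqueness.\<close>

lemma Sigma_p_raise:
  fixes p :: "real^'k"
  assumes "valid_rate p" "\<And>a. p$a \<le> v$a" "(\<Sum>a\<in>UNIV. v$a) \<le> 1"
  defines "u \<equiv> (\<chi> a. v$a + (1 - (\<Sum>b\<in>UNIV. v$b)) / real CARD('k))"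
  shows "u \<in> Sigma_p p" and "\<And>a. v$a \<le> u$a" and "(\<Sum>b\<in>UNIV. v$b) < 1 \<Longrightarrow> v$a < u$a"
proof -
  show le: "v$a \<le> u$a" for a using assms(3) by (simp add: u_def)
  show "v$a < u$a" if "(\<Sum>b\<in>UNIV. v$b) < 1" using that by (simp add: u_def)
  show "u \<in> Sigma_p p"
  proof (rule Sigma_pI)
    show "p$a \<le> u$a" for a using le[of a] assms(2)[of a] by simp
    moreover have "0 \<le> p$a" for a using assms(1) by (simp add: valid_rate_def)
    ultimately show "0 \<le> u$a" for a by (metis order_trans)
    show "(\<Sum>a\<in>UNIV. u$a) = 1" by (simp add: u_def sum.distrib)
  qed
qed

lemma Sigma_p_nonempty:
  fixes p :: "real^'k"
  assumes "valid_rate p" shows "Sigma_p p \<noteq> {}"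
  using Sigma_p_raise(1)[OF assms, of p] assms by (auto simp: valid_rate_def)

lemma compact_Sigma_p: "compact (Sigma_p (p :: real^'k))"
proof -
  have "closed {w :: real^'k. (\<forall>a. p$a \<le> w$a \<and> 0 \<le> w$a \<and> w$a \<le> 1) \<and> (\<Sum>a\<in>UNIV. w$a) = 1}"
    by (intro closed_Collect_conj closed_Collect_all closed_Collect_le closed_Collect_eq continuous_intros)
  moreover have "bounded (Sigma_p p)"
  proof (rule boundedI)
    fix w assume w: "w \<in> Sigma_p p"
    have "norm w \<le> (\<Sum>a\<in>UNIV. norm (w$a))" using norm_le_l1_cart[of w] by simp
    also have "\<dots> = 1" using w by (simp add: Sigma_p_def)
    finally show "norm w \<le> 1" .
  qed
  ultimately show ?thesis by (simp add: compact_eq_bounded_closed Sigma_p_def)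
qed

lemma argmax_util_exists:
  fixes lam :: "real^'k"
  assumes "uniq_best lam" "valid_rate p"
  shows "\<exists>w\<in>Sigma_p p. \<forall>v\<in>Sigma_p p. util lam v \<le> util lam w"
proof (rule continuous_attains_sup)
  show "compact (Sigma_p p)" by (rule compact_Sigma_p)
  show "Sigma_p p \<noteq> {}" using assms Sigma_p_nonempty by auto
  show "continuous_on (Sigma_p p) (util lam)"
    unfolding continuous_on_sequentially comp_def
    by (auto intro!: tendsto_util[OF assms(1) tendsto_const] intro: Sigma_p_nonneg)
qed

text \<open>Two maximisers with different weights on the best arm have a strictly better midpoint, by strict
  convexity of $1/x$. If these weights agree, the pointwise minimum is still optimal but has total mass
  below one, and spreading the missing mass over all arms improves it strictly.\<close>

lemma argmax_util_unique:
  fixes lam :: "real^'k"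
  assumes "uniq_best lam" "valid_rate p"
    and w: "w \<in> Sigma_p p" "\<And>u. u \<in> Sigma_p p \<Longrightarrow> util lam u \<le> util lam w"
    and v: "v \<in> Sigma_p p" "\<And>u. u \<in> Sigma_p p \<Longrightarrow> util lam u \<le> util lam v"
  shows "w = v"
proof (cases "(\<Sum>a\<in>UNIV. p$a) = 1")
  case True
  then show ?thesis using w v Sigma_p_eq_rate by metis
next
  case False
  then have p1: "(\<Sum>a\<in>UNIV. p$a) < 1" and p0: "\<And>a. 0 \<le> p$a"
    using assms(2) by (auto simp: valid_rate_def)
  define b where "b = best_arm lam"
  define V where "V = util lam w"
  have Vv: "V = util lam v" unfolding V_def using w v by (meson antisym)
  have max: "\<not> V < util lam u" if "u \<in> Sigma_p p" for u using w(2)[OF that] by (simp add: V_def)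
  \<comment> \<open>There is mass to spread, so some feasible point has full support. Hence the
    optimum is positive, both maximisers have positive weights, and reciprocals may be used.\<close>
  have "\<exists>u\<in>Sigma_p p. 0 < util lam u"
  proof
    define u where "u = (\<chi> a. p$a + (1 - (\<Sum>b\<in>UNIV. p$b)) / real CARD('k))"
    show u: "u \<in> Sigma_p p" unfolding u_def
      using assms(2) p1 by (intro Sigma_p_raise) auto
    have "p$a < u$a" for a unfolding u_def
      using assms(2) p1 by (intro Sigma_p_raise) auto
    then have "0 < u$a" for a using p0 by (meson le_less_trans)
    then show "0 < util lam u"
      using u by (subst util_pos_iff[OF assms(1)]) (auto intro: Sigma_p_nonneg)
  qed
  then have V0: "0 < V" using max by force
  have wpos: "0 < w$a" for a using V0 util_pos_iff[OF assms(1)] w(1) Sigma_p_nonneg unfolding V_def by blast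
  have vpos: "0 < v$a" for a using V0 util_pos_iff[OF assms(1)] v(1) Sigma_p_nonneg unfolding Vv by blast
  \<comment> \<open>The level that \<open>hmean\<close> has to reach for arm \<open>a\<close> to
    contribute at least the optimal value \<open>V\<close>. A feasible point strictly above all
    levels is a contradiction.\<close>
  define r where "r a = V / (gap lam a)\<^sup>2" for a
  have r: "0 < r a" if "a \<noteq> b" for a
    using V0 gap_pos[OF assms(1), of a] that by (simp add: r_def b_def)
  have rw: "r a \<le> hmean (w$a) (w$b)" if "a \<noteq> b" for a
    using le_util_iff[of V lam w] gap_pos[OF assms(1), of a] that unfolding V_def
    by (simp add: r_def b_def V_def pos_divide_le_eq mult.commute)
  have rv: "r a \<le> hmean (v$a) (v$b)" if "a \<noteq> b" for a
    using le_util_iff[of V lam v] gap_pos[OF assms(1), of a] that unfolding Vv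
    by (simp add: r_def b_def Vv pos_divide_le_eq mult.commute)
  have contra: False if "u \<in> Sigma_p p" "\<And>a. a \<noteq> b \<Longrightarrow> r a < hmean (u$a) (u$b)" for u
  proof -
    have "V < util lam u" unfolding less_util_iff
    proof (intro allI impI)
      fix a assume a: "a \<noteq> best_arm lam"
      then have "V / (gap lam a)\<^sup>2 < hmean (u$a) (u$(best_arm lam))" "0 < (gap lam a)\<^sup>2"
        using that(2)[of a] gap_pos[OF assms(1) a] by (auto simp: r_def b_def)
      then show "V < (gap lam a)\<^sup>2 * hmean (u$a) (u$(best_arm lam))"
        by (simp add: divide_less_eq mult.commute)
    qed
    then show False using max that(1) by simp
  qed
  show ?thesis
  proof (cases "w$b = v$b")
    case False
    define u where "u = (\<chi> a. (w$a + v$a) / 2)"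
    have "u \<in> Sigma_p p"
    proof (rule Sigma_pI)
      show "p$a \<le> u$a" for a
      proof -
        have "p$a \<le> w$a" "p$a \<le> v$a" using w(1) v(1) by (auto simp: Sigma_p_def)
        then show ?thesis by (simp add: u_def)
      qed
      show "0 \<le> u$a" for a using wpos[of a] vpos[of a] by (simp add: u_def)
      show "(\<Sum>a\<in>UNIV. u$a) = 1"
        using w(1) v(1) by (simp add: u_def Sigma_p_def sum_divide_distrib[symmetric] sum.distrib)
    qed
    moreover have "r a < hmean (u$a) (u$b)" if "a \<noteq> b" for a
    proof -
      have "1 / w$a + 1 / w$b \<le> 1 / r a" "1 / v$a + 1 / v$b \<le> 1 / r a"
        using le_hmean_iff rw rv r wpos vpos that by auto
      moreover have "1 / u$a \<le> (1 / w$a + 1 / v$a) / 2"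
        unfolding u_def using inverse_midpoint(1)[OF wpos vpos] by simp
      \<comment> \<open>The weight of the best arm occurs in every term, so strictness in this
        single coordinate improves all terms.\<close>
      moreover have "1 / u$b < (1 / w$b + 1 / v$b) / 2"
        unfolding u_def using inverse_midpoint(2)[OF wpos vpos False] by simp
      moreover have "x + y < R" if "A + B \<le> R" "C + D \<le> R" "x \<le> (A + C) / 2" "y < (B + D) / 2"
        for A B C D x y R :: real using that by argo
      ultimately have "1 / u$a + 1 / u$b < 1 / r a" by blast
      then show ?thesis using r[OF that] wpos vpos
        by (subst less_hmean_iff) (auto simp: u_def add_pos_pos)
    qed
    ultimately show ?thesis using contra by blast
  next
    case True
    define m where "m = (\<chi> a. min (w$a) (v$a))"
    show ?thesis
    proof (rule ccontr)
      assume "w \<noteq> v"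
      then obtain a where "w$a \<noteq> v$a" by (auto simp: vec_eq_iff)
      then have "m$a < w$a \<or> m$a < v$a" by (auto simp: m_def)
      moreover have "m$c \<le> w$c" "m$c \<le> v$c" for c by (auto simp: m_def)
      ultimately have "(\<Sum>a\<in>UNIV. m$a) < (\<Sum>a\<in>UNIV. w$a) \<or> (\<Sum>a\<in>UNIV. m$a) < (\<Sum>a\<in>UNIV. v$a)"
        by (auto intro!: sum_strict_mono_ex1)
      then have m1: "(\<Sum>a\<in>UNIV. m$a) < 1" using w(1) v(1) by (auto simp: Sigma_p_def)
      have pm: "p$a \<le> m$a" for a using w(1) v(1) by (simp add: m_def Sigma_p_def)
      have mpos: "0 < m$a" for a using wpos vpos by (simp add: m_def)
      define u where "u = (\<chi> a. m$a + (1 - (\<Sum>b\<in>UNIV. m$b)) / real CARD('k))"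
      have "u \<in> Sigma_p p" and mu: "m$a < u$a" for a
        unfolding u_def using m1 by (auto intro!: Sigma_p_raise[OF assms(2) pm] simp del: vec_lambda_beta)
      moreover have "r a < hmean (u$a) (u$b)" if "a \<noteq> b" for a
      proof -
        \<comment> \<open>As \<open>w\<close> and \<open>v\<close> agree at the best arm, the pair
          (\<open>m$a\<close>, \<open>m$b\<close>) is the pair of one of the two maximisers.\<close>
        have "r a \<le> hmean (m$a) (m$b)" using rw[OF that] rv[OF that] True by (simp add: m_def min_def)
        also have "\<dots> < hmean (u$a) (u$b)" by (intro hmean_strict_mono mpos mu)
        finally show ?thesis .
      qed
      ultimately show False using contra by blast
    qed
  qed
qed

lemma valid_rate_rate: "valid_fairness F \<Longrightarrow> valid_rate (rate F lam)"
  by (cases F) auto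

lemma wstar_argmax:
  fixes lam :: "real^'k"
  assumes "uniq_best lam" "valid_fairness F"
  shows "wstar F lam \<in> Sigma_p (rate F lam)"
    and "\<And>v. v \<in> Sigma_p (rate F lam) \<Longrightarrow> obj lam (wstar F lam) \<le> obj lam v"
proof -
  let ?P = "\<lambda>w. w \<in> Sigma_p (rate F lam) \<and> (\<forall>v\<in>Sigma_p (rate F lam). obj lam w \<le> obj lam v)"
  have "\<exists>w. ?P w"
    using argmax_util_exists[OF assms(1) valid_rate_rate[OF assms(2), of lam]]
      obj_le_iff[OF assms(1)] Sigma_p_nonneg by meson
  then have "?P (SOME w. ?P w)" by (rule someI_ex)
  then show "wstar F lam \<in> Sigma_p (rate F lam)"
    and "\<And>v. v \<in> Sigma_p (rate F lam) \<Longrightarrow> obj lam (wstar F lam) \<le> obj lam v"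
    using assms(1) by (auto simp: wstar_def)
qed

text \<open>Uniqueness turns the choice behind \<open>wstar\<close> into a characterisation, which
  is how limits of optimal weights are recognised.\<close>

lemma wstar_eqI:
  fixes lam :: "real^'k"
  assumes "uniq_best lam" "valid_fairness F" "w \<in> Sigma_p (rate F lam)"
    and "\<And>v. v \<in> Sigma_p (rate F lam) \<Longrightarrow> util lam v \<le> util lam w"
  shows "w = wstar F lam"
proof (rule argmax_util_unique[OF assms(1) valid_rate_rate[OF assms(2)] assms(3,4)])
  show "wstar F lam \<in> Sigma_p (rate F lam)" using wstar_argmax assms by auto
  show "util lam u \<le> util lam (wstar F lam)" if "u \<in> Sigma_p (rate F lam)" for u
    using wstar_argmax[OF assms(1,2)] obj_le_iff[OF assms(1)] that Sigma_p_nonneg by meson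
qed

lemma Tstar_eq_obj_wstar:
  fixes lam :: "real^'k"
  assumes "uniq_best lam" "valid_fairness F"
  shows "Tstar (rate F lam) lam = 2 * obj lam (wstar F lam)"
proof -
  have "(INF w\<in>Sigma_p (rate F lam). obj lam w) = obj lam (wstar F lam)"
  proof (rule antisym)
    show "(INF w\<in>Sigma_p (rate F lam). obj lam w) \<le> obj lam (wstar F lam)"
      by (rule INF_lower[OF wstar_argmax(1)[OF assms]])
    show "obj lam (wstar F lam) \<le> (INF w\<in>Sigma_p (rate F lam). obj lam w)"
      by (rule INF_greatest[OF wstar_argmax(2)[OF assms]])
  qed
  then show ?thesis by (simp add: Tstar_def)
qed

section \<open>Continuity and measurability of the optimal weights\<close>

lemma continuous_rate:
  assumes "valid_fairness F"
  shows "continuous_on UNIV (rate F :: real^'k \<Rightarrow> real^'k)"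
proof (cases F)
  case (Prespec p)
  then have "rate F = (\<lambda>_. p)" by (intro ext) simp
  then show ?thesis by (simp only: continuous_on_const)
next
  case (Dep p)
  then have "rate F = p" by (intro ext) simp
  moreover have "continuous_on UNIV p" using assms Dep by simp
  ultimately show ?thesis by (simp only:)
qed



text \<open>Closed graph theorem with values in the compact simplex: it suffices that a limit of
  optimal weights is optimal for the limit parameter. The difficulty is that a competitor
  \<open>v\<close> at the limit is not feasible for the nearby rates and has to be approximated by
  points that are.\<close>

lemma continuous_on_wstar:
  assumes "valid_fairness F"
  shows "continuous_on {lam :: real^'k. uniq_best lam} (wstar F)"
proof -
  let ?S = "{lam :: real^'k. uniq_best lam}" and ?T = "Sigma_p (0 :: real^'k)"
  define graph where "graph = (\<lambda>x. (x, wstar F x)) ` ?S"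
  have ST: "wstar F \<in> ?S \<rightarrow> ?T"
  proof
    fix lam assume "lam \<in> ?S"
    then have "wstar F lam \<in> Sigma_p (rate F lam)" using wstar_argmax(1) assms by simp
    then show "wstar F lam \<in> ?T" by (simp add: Sigma_p_def)
  qed
  have "?S \<times> ?T \<inter> closure graph \<subseteq> graph"
  proof
    fix l assume "l \<in> ?S \<times> ?T \<inter> closure graph"
    moreover obtain lam w where l: "l = (lam, w)" by (cases l)
    ultimately have u: "uniq_best lam" and wT: "w \<in> ?T" and "(lam, w) \<in> closure graph"
      by simp_all
    then obtain x where xg: "\<And>n. x n \<in> graph" and lim: "x \<longlonglongrightarrow> (lam, w)"
      unfolding closure_sequential by metis
    define X where "X n = fst (x n)" for n
    have x: "x n = (X n, wstar F (X n))" and X: "uniq_best (X n)" for n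
      using xg[of n] by (auto simp: X_def graph_def)
    have XL: "X \<longlonglongrightarrow> lam" using tendsto_fst[OF lim] by (simp add: X_def[abs_def])
    have WL: "(\<lambda>n. wstar F (X n)) \<longlonglongrightarrow> w" using tendsto_snd[OF lim] by (simp add: x)
    define p where "p = rate F lam"
    have PL: "(\<lambda>n. rate F (X n)) \<longlonglongrightarrow> p"
      unfolding p_def using continuous_rate[OF assms] XL
      by (auto simp: continuous_on_eq_continuous_at intro: isCont_tendsto_compose)
    have wS: "w \<in> Sigma_p p"
    proof -
      have "p$a \<le> w$a" for a
        using wstar_argmax(1)[OF X assms]
        by (intro LIMSEQ_le[OF tendsto_vec_nth[OF PL] tendsto_vec_nth[OF WL]]) (auto simp: Sigma_p_def)
      then show ?thesis using wT by (auto simp: Sigma_p_def)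
    qed
    have "w = wstar F lam"
    proof (cases "(\<Sum>a\<in>UNIV. p$a) = 1")
      case True
      then show ?thesis using Sigma_p_eq_rate wS wstar_argmax(1)[OF u assms] unfolding p_def by metis
    next
      case False
      show ?thesis
      proof (rule wstar_eqI[OF u assms])
        show "w \<in> Sigma_p (rate F lam)" using wS by (simp add: p_def)
        fix v assume "v \<in> Sigma_p (rate F lam)"
        then have v: "v \<in> Sigma_p p" by (simp add: p_def)
        have p1: "(\<Sum>a\<in>UNIV. p$a) < 1"
          using False valid_rate_rate[OF assms, of lam] by (simp add: p_def valid_rate_def)
        define Q where "Q n = rate F (X n)" for n
        \<comment> \<open>The excess of \<open>v\<close> over the limit rates is rescaled to exactly
          the mass that the nearby rates leave free; the factor tends to 1 because the limit rates
          leave positive mass.\<close>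
        define c where "c n = (1 - (\<Sum>a\<in>UNIV. Q n$a)) / (1 - (\<Sum>a\<in>UNIV. p$a))" for n
        define W where "W n = Q n + c n *\<^sub>R (v - p)" for n
        have Q: "valid_rate (Q n)" for n unfolding Q_def by (rule valid_rate_rate[OF assms])
        have QL: "Q \<longlonglongrightarrow> p" using PL by (simp add: Q_def[abs_def])
        have "c \<longlonglongrightarrow> (1 - (\<Sum>a\<in>UNIV. p$a)) / (1 - (\<Sum>a\<in>UNIV. p$a))"
          unfolding c_def using p1 by (intro tendsto_intros QL) auto
        then have cL: "c \<longlonglongrightarrow> 1" using p1 by simp
        have "W \<longlonglongrightarrow> p + 1 *\<^sub>R (v - p)"
          unfolding W_def by (intro tendsto_intros QL cL)
        then have VL: "W \<longlonglongrightarrow> v" by simp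
        have W: "W n \<in> Sigma_p (Q n)" for n
        proof (rule Sigma_pI)
          have c: "0 \<le> c n" using Q[of n] p1 by (simp add: c_def valid_rate_def)
          then show "Q n$a \<le> W n$a" for a using v by (simp add: W_def Sigma_p_def)
          moreover have "0 \<le> Q n$a" for a using Q[of n] by (simp add: valid_rate_def)
          ultimately show "0 \<le> W n$a" for a by (metis order_trans)
          have "(\<Sum>a\<in>UNIV. W n$a) = (\<Sum>a\<in>UNIV. Q n$a) + c n * ((\<Sum>a\<in>UNIV. v$a) - (\<Sum>a\<in>UNIV. p$a))"
            by (simp add: W_def sum.distrib sum_distrib_left sum_subtractf right_diff_distrib)
          also have "\<dots> = 1" using v p1 by (simp add: Sigma_p_def c_def)
          finally show "(\<Sum>a\<in>UNIV. W n$a) = 1" .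
        qed
        have "util (X n) (W n) \<le> util (X n) (wstar F (X n))" for n
          using wstar_argmax[OF X assms] obj_le_iff[OF X] W[of n] Sigma_p_nonneg
          unfolding Q_def by meson
        moreover have "(\<lambda>n. util (X n) (W n)) \<longlonglongrightarrow> util lam v"
          using W v by (intro tendsto_util u XL VL) (auto intro: Sigma_p_nonneg)
        moreover have "(\<lambda>n. util (X n) (wstar F (X n))) \<longlonglongrightarrow> util lam w"
          using wS wstar_argmax(1)[OF X assms]
          by (intro tendsto_util u XL WL) (auto intro: Sigma_p_nonneg)
        ultimately show "util lam v \<le> util lam w" by (meson LIMSEQ_le)
      qed
    qed
    then show "l \<in> graph" using l u by (auto simp: graph_def)
  qed
  moreover have "graph \<subseteq> ?S \<times> ?T" using ST by (auto simp: graph_def)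
  ultimately have "graph = ?S \<times> ?T \<inter> closure graph" using closure_subset by blast
  then have "closedin (top_of_set (?S \<times> ?T)) graph" by (metis closed_closure closedin_closed)
  then show ?thesis
    using continuous_closed_graph_eq[OF compact_Sigma_p ST] by (simp add: graph_def)
qed

text \<open>Continuity on the open set without ties and a constant value on the closed set of
  ties.\<close>

lemma measurable_wstar:
  assumes "valid_fairness F"
  shows "(wstar F :: real^'k \<Rightarrow> real^'k) \<in> borel_measurable borel"
proof -
  have "(\<lambda>lam :: real^'k. if lam \<in> {lam. uniq_best lam} then wstar F lam else pic F) \<in> borel_measurable borel"
    using continuous_on_wstar[OF assms] open_uniq_best
    by (intro borel_measurable_continuous_on_if borel_open) auto
  moreover have "(\<lambda>lam :: real^'k. if lam \<in> {lam. uniq_best lam} then wstar F lam else pic F) = wstar F"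
    by (auto simp: wstar_def fun_eq_iff)
  ultimately show ?thesis by metis
qed


text \<open>At ties \<open>wstar\<close> falls back on \<open>pic F\<close>, hence the first
  hypothesis, which becomes available only under the condition \<open>slack\<close> below.\<close>

lemma wstar_simplex:
  assumes "pic F \<in> Sigma_p 0" "valid_fairness F"
  shows "wstar F (lam :: real^'k) \<in> Sigma_p 0"
proof (cases "uniq_best lam")
  case True
  then show ?thesis using wstar_argmax(1)[OF True assms(2)] by (simp add: Sigma_p_def)
next
  case False
  then show ?thesis using assms(1) by (simp add: wstar_def)
qed

end

section \<open>Exploration: the constant policy and its schedule\<close>

text \<open>\<open>slack\<close> excludes prespecified rates that sum to one while some arm has rate
  zero. In that case \<open>pic F\<close> and the only feasible allocation both vanish at this arm,
  and nothing would ever explore it.\<close>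

locale ftas = several_arms arms for arms :: "'k::{finite,linorder} itself" +
  fixes F :: "'k fairness" and theta :: "(real, 'k) vec"
  assumes uniq: "uniq_best theta"
    and valid: "valid_fairness F"
    and slack: "\<forall>p. F = Prespec p \<longrightarrow> (\<Sum>a\<in>UNIV. p$a) < 1 \<or> (\<forall>a. 0 < p$a)"
begin

lemma pic_pos_sum: "(\<forall>a. 0 < pic F$a) \<and> (\<Sum>a\<in>UNIV. pic F$a) = 1"
proof (cases F)
  case (Dep p)
  then show ?thesis by simp
next
  case (Prespec p)
  define ps where "ps = (\<Sum>a\<in>UNIV. p$a)"
  have p: "0 \<le> p$a" for a using valid Prespec by (simp add: valid_rate_def)
  have ps: "ps \<le> 1" using valid Prespec by (simp add: valid_rate_def ps_def)
  show ?thesis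
  proof (cases "{a. p$a = 0} = {}")
    case True
    then have "0 < p$a" for a using p[of a] by (auto simp: order_le_less)
    moreover have "0 \<le> (1 - ps) / real CARD('k)" using ps by simp
    ultimately have "0 < p$a + (1 - ps) / real CARD('k)" for a by (metis add_pos_nonneg)
    moreover have "pic F = (\<chi> a. p$a + (1 - ps) / real CARD('k))"
      using True Prespec by (simp add: Let_def ps_def)
    ultimately show ?thesis by (simp add: sum.distrib ps_def)
  next
    case False
    define K0 where "K0 = card {a. p$a = 0}"
    have K0: "0 < K0" using False by (simp add: K0_def card_gt_0_iff)
    have "\<not> (\<forall>a. 0 < p$a)" using False by (metis (mono_tags, lifting) Collect_empty_eq less_irrefl)
    \<comment> \<open>Some arm has rate zero, so \<open>slack\<close> leaves positive mass to share
      among such arms.\<close>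
    then have ps1: "ps < 1" using slack Prespec by (auto simp: ps_def)
    have eq: "pic F = (\<chi> a. if p$a > 0 then p$a else (1 - ps) / real K0)"
      using K0 Prespec unfolding Prespec pic.simps Let_def ps_def[symmetric] K0_def[symmetric]
      by (simp only: less_imp_neq[THEN not_sym] if_False)
    have "pic F$a = p$a + (if p$a = 0 then (1 - ps) / real K0 else 0)" for a
      using p[of a] by (auto simp: eq)
    then have "(\<Sum>a\<in>UNIV. pic F$a) = ps + (\<Sum>a\<in>UNIV. if p$a = 0 then (1 - ps) / real K0 else 0)"
      by (simp add: sum.distrib ps_def)
    also have "(\<Sum>a\<in>UNIV. if p$a = 0 then (1 - ps) / real K0 else 0) = real K0 * ((1 - ps) / real K0)"
      by (simp add: sum.If_cases K0_def)
    also have "\<dots> = 1 - ps" using K0 by simp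
    finally have "(\<Sum>a\<in>UNIV. pic F$a) = 1" by simp
    moreover have "0 < (1 - ps) / real K0" using ps1 K0 by simp
    ultimately show ?thesis by (simp add: eq)
  qed
qed

lemma pic_pos: "0 < pic F$a" using pic_pos_sum by blast

lemma pic_simplex: "pic F \<in> Sigma_p 0"
  using pic_pos_sum by (intro Sigma_pI) (auto simp: less_imp_le)

lemma wstar_in_simplex: "wstar F lam \<in> Sigma_p 0"
  by (rule wstar_simplex[OF pic_simplex valid])

text \<open>Rounds start at 1. At 0 division by zero gives \<open>eps 0 = 0\<close>, so positivity
  holds for successors only.\<close>

lemma eps_bounds: "0 < eps (Suc t)" "eps (Suc t) \<le> 1"
proof -
  define y where "y = sqrt (real (Suc t))"
  have "1 \<le> y" by (simp add: y_def)
  then show "0 < eps (Suc t)" "eps (Suc t) \<le> 1" unfolding eps_def y_def[symmetric] by auto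
qed

lemma policy_nth: "policy F t lam$a = (1 - eps t) * wstar F lam$a + eps t * pic F$a"
  by (simp add: policy_def)

lemma policy_simplex: "policy F (Suc t) lam \<in> Sigma_p 0"
proof (rule Sigma_pI)
  show "0 \<le> policy F (Suc t) lam$a" for a
    unfolding policy_nth using eps_bounds[of t] pic_pos[of a] Sigma_p_nonneg[OF wstar_in_simplex[of lam], of a]
    by simp
  then show "(0::(real, 'k) vec)$a \<le> policy F (Suc t) lam$a" for a by simp
  have "(\<Sum>a\<in>UNIV. policy F (Suc t) lam$a) =
      (1 - eps (Suc t)) * (\<Sum>a\<in>UNIV. wstar F lam$a) + eps (Suc t) * (\<Sum>a\<in>UNIV. pic F$a)"
    by (simp add: policy_nth sum.distrib sum_distrib_left)
  then show "(\<Sum>a\<in>UNIV. policy F (Suc t) lam$a) = 1"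
    using wstar_in_simplex[of lam] pic_pos_sum by (simp add: Sigma_p_def)
qed

text \<open>The policy is bounded below in two ways: this bound is uniform in the parameter and
  forces exploration, while \<open>policy_ge_wstar\<close> makes the counts follow the optimal
  weights.\<close>

lemma policy_ge_forced: "eps (Suc t) * pic F$a \<le> policy F (Suc t) lam$a"
  unfolding policy_nth using eps_bounds[of t] Sigma_p_nonneg[OF wstar_in_simplex[of lam], of a] by simp

lemma policy_ge_wstar: "wstar F lam$a - eps (Suc t) \<le> policy F (Suc t) lam$a"
proof -
  have "wstar F lam$a \<le> 1" using wstar_in_simplex[of lam] by (simp add: Sigma_p_def)
  then have "eps (Suc t) * wstar F lam$a \<le> eps (Suc t)"
    using eps_bounds[of t] by (simp add: mult_left_le)
  moreover have "0 \<le> eps (Suc t) * pic F$a" using eps_bounds[of t] pic_pos[of a] by simp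
  ultimately show ?thesis unfolding policy_nth by (simp add: left_diff_distrib)
qed

text \<open>The lower bound replaces each term by the smallest one; the upper bound telescopes, as 1
  / (2 * sqrt (t + 1)) is at most sqrt (t + 1) - sqrt t. The first measures the exploration that is
  forced, the second its cost.\<close>

lemma sum_eps: "sqrt (real t) / 2 \<le> (\<Sum>s<t. eps (Suc s))" "(\<Sum>s<t. eps (Suc s)) \<le> sqrt (real t)"
proof -
  have "(\<Sum>s<t. 1 / (2 * sqrt (real t))) \<le> (\<Sum>s<t. eps (Suc s))"
    unfolding eps_def by (intro sum_mono divide_left_mono mult_left_mono) auto
  also have "(\<Sum>s<t. 1 / (2 * sqrt (real t))) = sqrt (real t) / 2"
    by (simp add: real_div_sqrt)
  finally show "sqrt (real t) / 2 \<le> (\<Sum>s<t. eps (Suc s))" .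
  show "(\<Sum>s<t. eps (Suc s)) \<le> sqrt (real t)"
  proof (induction t)
    case (Suc t)
    define x y where "x = sqrt (real t)" and "y = sqrt (real (Suc t))"
    have y: "0 < y" by (simp add: y_def)
    have "y * y = x * x + 1" unfolding x_def y_def by simp
    moreover have "0 \<le> (y - x) * (y - x)" by simp
    ultimately have "2 * y * x + 1 \<le> 2 * y * y" by (simp add: algebra_simps)
    then have "x + 1 / (2 * y) \<le> y" using y by (simp add: field_simps)
    then show ?case using Suc by (simp add: x_def y_def eps_def)
  qed simp
qed

end

section \<open>Sampling from a policy and single-round exponential moments\<close>

lemma sample_eqI:
  fixes q :: "(real, 'k::{finite,linorder}) vec"
  assumes "\<And>a. 0 \<le> q$a" "(\<Sum>b\<in>{..<a}. q$b) \<le> u" "u < (\<Sum>b\<in>{..a}. q$b)"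
  shows "sample q u = a"
proof -
  have "(LEAST c. u < (\<Sum>b\<in>{..c}. q$b)) = a"
  proof (rule Least_equality)
    show "a \<le> c" if c: "u < (\<Sum>b\<in>{..c}. q$b)" for c
    proof (rule ccontr)
      assume "\<not> a \<le> c"
      then have "(\<Sum>b\<in>{..c}. q$b) \<le> (\<Sum>b\<in>{..<a}. q$b)"
        using assms(1) by (intro sum_mono2) auto
      then show False using c assms(2) by linarith
    qed
  qed fact
  then show ?thesis using assms(3) unfolding sample_def by metis
qed

text \<open>Eliminates \<open>LEAST\<close> in favour of finitely many comparisons of
  \<open>u\<close> with prefix sums, from which measurability can be read off. The second disjunct
  is the default arm.\<close>

lemma sample_eq_iff:
  fixes q :: "(real, 'k::{finite,linorder}) vec"
  shows "sample q u = a \<longleftrightarrow>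
    (u < (\<Sum>b\<in>{..a}. q$b) \<and> (\<forall>c\<in>{..<a}. \<not> u < (\<Sum>b\<in>{..c}. q$b))) \<or>
    (a = Max UNIV \<and> (\<forall>c. \<not> u < (\<Sum>b\<in>{..c}. q$b)))"
proof (cases "\<exists>c. u < (\<Sum>b\<in>{..c}. q$b)")
  case True
  let ?S = "{c. u < (\<Sum>b\<in>{..c}. q$b)}"
  have "sample q u = Min ?S"
    using True by (simp add: sample_def Least_Min)
  moreover have "Min ?S = a \<longleftrightarrow> a \<in> ?S \<and> (\<forall>c\<in>?S. a \<le> c)"
    using True by (intro Min_eq_iff) auto
  ultimately show ?thesis using True by (auto simp: not_less[symmetric])
next
  case False
  then show ?thesis by (auto simp: sample_def)
qed

lemma measurable_sample:
  fixes q :: "'b \<Rightarrow> (real, 'k::{finite,linorder}) vec"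
  assumes "\<And>a. (\<lambda>x. q x$a) \<in> borel_measurable M" and [measurable]: "u \<in> borel_measurable M"
  shows "(\<lambda>x. sample (q x) (u x)) \<in> measurable M (count_space UNIV)"
proof -
  have [measurable]: "(\<lambda>x. \<Sum>b\<in>B. q x$b) \<in> borel_measurable M" for B
    using assms(1) by (rule borel_measurable_sum)
  have "{x \<in> space M. sample (q x) (u x) = a} \<in> sets M" for a
    unfolding sample_eq_iff by measurable
  then show ?thesis
    by (subst measurable_count_space_eq2) (auto simp: vimage_def Int_def conj_commute)
qed

lemma sets_sample: "{u. sample q u = a} \<in> sets borel"
proof -
  have "(\<lambda>u. sample q u) \<in> measurable borel (count_space UNIV)"
    by (rule measurable_sample) auto
  from measurable_sets[OF this, of "{a}"] show ?thesis by (simp add: vimage_def)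
qed

section \<open>The law of one round\<close>

abbreviation gauss :: "real \<Rightarrow> real measure" where
  "gauss m \<equiv> density lborel (normal_density m 1)"

abbreviation unif :: "real measure" where
  "unif \<equiv> uniform_measure lborel {0..1::real}"

lemma prob_space_unif: "prob_space unif"
  by (intro prob_space_uniform_measure) auto

lemma prob_space_gauss: "prob_space (gauss m)"
  by (simp add: prob_space_normal_density)

lemma product_prob_gauss: "product_prob_space (\<lambda>a. gauss (m a))"
  using prob_space_gauss
  by (simp add: product_prob_space_def product_prob_space_axioms_def product_sigma_finite_def prob_space_imp_sigma_finite)

lemma prob_space_round: "prob_space (round_meas (theta :: (real, 'k::finite) vec))"
proof -
  interpret U: prob_space unif by (rule prob_space_unif)
  interpret G: prob_space "\<Pi>\<^sub>M a\<in>(UNIV::'k set). gauss (theta$a)"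
    by (intro prob_space_PiM prob_space_gauss)
  interpret pair_prob_space unif "\<Pi>\<^sub>M a\<in>(UNIV::'k set). gauss (theta$a)" ..
  show ?thesis unfolding round_meas_def by unfold_locales
qed

lemma product_prob_round: "product_prob_space (\<lambda>t. round_meas (theta :: (real, 'k::finite) vec))"
  using prob_space_round[of theta]
  by (simp add: product_prob_space_def product_prob_space_axioms_def product_sigma_finite_def prob_space_imp_sigma_finite)

lemma measurable_fst_round: "fst \<in> borel_measurable (round_meas theta)"
  unfolding round_meas_def by (rule measurable_compose[OF measurable_fst]) (simp add: measurable_def)

lemma measurable_snd_round: "(\<lambda>x. snd x a) \<in> borel_measurable (round_meas theta)"
proof -
  have "(\<lambda>y. y a) \<in> borel_measurable (\<Pi>\<^sub>M a\<in>UNIV. gauss (theta$a))"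
    using measurable_component_singleton[of a UNIV "\<lambda>a. gauss (theta$a)"] by simp
  then show ?thesis unfolding round_meas_def by (rule measurable_compose[OF measurable_snd])
qed

lemma nn_integral_round:
  fixes theta :: "(real, 'k::finite) vec"
  assumes "f \<in> borel_measurable (round_meas theta)"
  shows "(\<integral>\<^sup>+x. f x \<partial>round_meas theta) = (\<integral>\<^sup>+u. \<integral>\<^sup>+y. f (u, y) \<partial>(\<Pi>\<^sub>M a\<in>UNIV. gauss (theta$a)) \<partial>unif)"
proof -
  interpret G: prob_space "\<Pi>\<^sub>M a\<in>(UNIV::'k set). gauss (theta$a)"
    by (intro prob_space_PiM prob_space_gauss)
  show ?thesis using G.nn_integral_fst[of f unif] assms unfolding round_meas_def by simp
qed

text \<open>Exponential tilting: completing the square turns the integrand times the density into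
  the normal density with mean \<open>m + l\<close>.\<close>

lemma gauss_exp_integral:
  "(\<integral>\<^sup>+y. ennreal (exp (l * (y - m) - l\<^sup>2 / 2)) \<partial>gauss m) = 1"
proof -
  have eq: "normal_density m 1 y * exp (l * (y - m) - l\<^sup>2 / 2) = normal_density (m + l) 1 y" for y
    unfolding normal_density_def
    by (simp add: exp_add[symmetric] power2_eq_square field_simps)
  have "(\<integral>\<^sup>+y. ennreal (exp (l * (y - m) - l\<^sup>2 / 2)) \<partial>gauss m)
      = (\<integral>\<^sup>+y. ennreal (normal_density (m + l) 1 y) \<partial>lborel)"
    by (subst nn_integral_density) (auto simp: ennreal_mult'[symmetric] eq)
  also have "\<dots> = emeasure (gauss (m + l)) (space (gauss (m + l)))"
    by (simp add: emeasure_density)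
  also have "\<dots> = 1" by (rule prob_space.emeasure_space_1[OF prob_space_gauss])
  finally show ?thesis .
qed

lemma gauss_product_exp_integral:
  fixes theta :: "(real, 'k::finite) vec"
  shows "(\<integral>\<^sup>+y. ennreal (exp (l * (y a - theta$a) - l\<^sup>2 / 2)) \<partial>(\<Pi>\<^sub>M a\<in>UNIV. gauss (theta$a))) = 1"
proof -
  interpret product_prob_space "\<lambda>a. gauss (theta$a)" UNIV by (rule product_prob_gauss)
  have "gauss (theta$a) = distr (\<Pi>\<^sub>M a\<in>UNIV. gauss (theta$a)) (gauss (theta$a)) (\<lambda>y. y a)"
    by (subst PiM_component) auto
  then have "(\<integral>\<^sup>+y. ennreal (exp (l * (y - theta$a) - l\<^sup>2 / 2)) \<partial>gauss (theta$a)) =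
     (\<integral>\<^sup>+y. ennreal (exp (l * (y - theta$a) - l\<^sup>2 / 2)) \<partial>distr (\<Pi>\<^sub>M a\<in>UNIV. gauss (theta$a)) (gauss (theta$a)) (\<lambda>y. y a))"
    by simp
  also have "\<dots> = (\<integral>\<^sup>+y. ennreal (exp (l * (y a - theta$a) - l\<^sup>2 / 2)) \<partial>(\<Pi>\<^sub>M a\<in>UNIV. gauss (theta$a)))"
    by (intro nn_integral_distr measurable_component_singleton) auto
  finally show ?thesis by (simp add: gauss_exp_integral)
qed

text \<open>Logarithm of one factor of the reward supermartingale: the tilted centred reward minus
  its Gaussian log-Laplace transform, and nothing in rounds where \<open>a\<close> is not
  drawn.\<close>

definition reward_step :: "real \<Rightarrow> 'k \<Rightarrow> (real, 'k::{finite,linorder}) vec \<Rightarrow> (real, 'k) vec \<Rightarrow> real \<times> ('k \<Rightarrow> real) \<Rightarrow> real" where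
  "reward_step l a theta q x = (if sample q (fst x) = a then l * (snd x a - theta$a) - l\<^sup>2 / 2 else 0)"

text \<open>If an event has probability P, then exp (- l) raised to its indicator has mean 1 - (1 -
  exp (- l)) * P, at most exp (- (1 - exp (- l)) * P). The first summand compensates this; large
  sums mean that \<open>a\<close> is drawn too rarely.\<close>

definition count_step :: "real \<Rightarrow> 'k \<Rightarrow> (real, 'k::{finite,linorder}) vec \<Rightarrow> real \<times> ('k \<Rightarrow> real) \<Rightarrow> real" where
  "count_step l a q x = (1 - exp (- l)) * q$a - (if sample q (fst x) = a then l else 0)"

text \<open>Integrating the rewards first, with the uniform number held fixed, the drawn arm is
  known, and the inner integral is 1 whether or not it is \<open>a\<close>.\<close>

lemma reward_step_integral:
  fixes theta :: "(real, 'k::{finite,linorder}) vec"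
  shows "(\<integral>\<^sup>+x. ennreal (exp (reward_step l a theta q x)) \<partial>round_meas theta) \<le> 1"
proof -
  interpret U: prob_space unif by (rule prob_space_unif)
  interpret G: prob_space "\<Pi>\<^sub>M a\<in>(UNIV::'k set). gauss (theta$a)"
    by (intro prob_space_PiM prob_space_gauss)
  have [measurable]: "(\<lambda>x. sample q (fst x)) \<in> measurable (round_meas theta) (count_space UNIV)"
    by (intro measurable_sample measurable_fst_round) auto
  have [measurable]: "(\<lambda>x. snd x a) \<in> borel_measurable (round_meas theta)" for a
    by (rule measurable_snd_round)
  have "(\<integral>\<^sup>+x. ennreal (exp (reward_step l a theta q x)) \<partial>round_meas theta) =
     (\<integral>\<^sup>+u. \<integral>\<^sup>+y. ennreal (exp (reward_step l a theta q (u, y))) \<partial>(\<Pi>\<^sub>M a\<in>UNIV. gauss (theta$a)) \<partial>unif)"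
    unfolding reward_step_def by (rule nn_integral_round) measurable
  also have "(\<integral>\<^sup>+y. ennreal (exp (reward_step l a theta q (u, y))) \<partial>(\<Pi>\<^sub>M a\<in>UNIV. gauss (theta$a))) = 1" for u
    using gauss_product_exp_integral[where l=l and a=a and theta=theta] G.emeasure_space_1
    by (cases "sample q u = a") (simp_all add: reward_step_def)
  then have "(\<integral>\<^sup>+u. \<integral>\<^sup>+y. ennreal (exp (reward_step l a theta q (u, y))) \<partial>(\<Pi>\<^sub>M a\<in>UNIV. gauss (theta$a)) \<partial>unif) = 1"
    using U.emeasure_space_1 by simp
  finally show ?thesis by simp
qed

text \<open>Arm \<open>a\<close> is drawn on the half-open interval between consecutive prefix sums,
  which has length \<open>q$a\<close> and lies in the unit interval. A lower bound is enough, since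
  only scarcity of draws has to be controlled.\<close>

lemma emeasure_sample_ge:
  fixes q :: "(real, 'k::{finite,linorder}) vec"
  assumes q: "q \<in> Sigma_p 0"
  shows "ennreal (q$a) \<le> emeasure unif {u. sample q u = a}"
proof -
  define c where "c = (\<Sum>b\<in>{..<a}. q$b)"
  have q0: "0 \<le> q$b" for b using q by (simp add: Sigma_p_def)
  have c0: "0 \<le> c" by (simp add: c_def sum_nonneg q0)
  have "{..a} = insert a {..<a}" by auto
  then have d: "(\<Sum>b\<in>{..a}. q$b) = c + q$a" by (simp add: c_def)
  have "(\<Sum>b\<in>{..a}. q$b) \<le> (\<Sum>b\<in>UNIV. q$b)" by (intro sum_mono2) (auto simp: q0)
  then have d1: "c + q$a \<le> 1" using q d by (simp add: Sigma_p_def)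
  have S: "{u. sample q u = a} \<in> sets lborel" using sets_sample by simp
  have sub: "{c..<c + q$a} \<subseteq> {0..1} \<inter> {u. sample q u = a}"
    using sample_eqI[OF q0, of a] c0 d1 d by (auto simp: c_def)
  have "ennreal (q$a) = emeasure lborel {c..<c + q$a}" using q0[of a] by simp
  also have "\<dots> \<le> emeasure lborel ({0..1} \<inter> {u. sample q u = a})"
    using S by (intro emeasure_mono[OF sub]) auto
  also have "\<dots> = emeasure unif {u. sample q u = a}"
    using S by (subst emeasure_uniform_measure) (auto simp: divide_ennreal_def)
  finally show ?thesis .
qed

text \<open>Rests on 1 - x \<le> exp (- x). The sign of \<open>l\<close> makes 1 - exp (- l)
  nonnegative, so that \<open>q$a\<close> may replace the true drawing probability.\<close>

lemma count_step_integral: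
  fixes q :: "(real, 'k::{finite,linorder}) vec"
  assumes "0 \<le> l" and q: "q \<in> Sigma_p 0"
  shows "(\<integral>\<^sup>+x. ennreal (exp (count_step l a q x)) \<partial>round_meas theta) \<le> 1"
proof -
  interpret U: prob_space unif by (rule prob_space_unif)
  interpret G: prob_space "\<Pi>\<^sub>M a\<in>(UNIV::'k set). gauss (theta$a)"
    by (intro prob_space_PiM prob_space_gauss)
  have [measurable]: "(\<lambda>x. sample q (fst x)) \<in> measurable (round_meas theta) (count_space UNIV)"
    by (intro measurable_sample measurable_fst_round) auto
  define A where "A = {u. sample q u = a}"
  have A: "A \<in> sets unif" using sets_sample by (simp add: A_def)
  define c where "c = (1 - exp (- l)) * q$a"
  define P where "P = measure unif A"
  have EA: "emeasure unif A = ennreal P" by (simp add: P_def U.emeasure_eq_measure)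
  have "measure unif (- A) = 1 - P"
    using U.prob_compl[OF A] by (simp add: P_def Compl_eq_Diff_UNIV)
  then have EcA: "emeasure unif (- A) = ennreal (1 - P)" by (simp add: U.emeasure_eq_measure)
  have P: "q$a \<le> P" "P \<le> 1" "0 \<le> P"
    using emeasure_sample_ge[OF q, of a] EA by (auto simp: A_def[symmetric] P_def)
  have "(\<integral>\<^sup>+x. ennreal (exp (count_step l a q x)) \<partial>round_meas theta) =
     (\<integral>\<^sup>+u. \<integral>\<^sup>+y. ennreal (exp (count_step l a q (u, y))) \<partial>(\<Pi>\<^sub>M a\<in>UNIV. gauss (theta$a)) \<partial>unif)"
    unfolding count_step_def by (rule nn_integral_round) measurable
  also have "\<dots> = (\<integral>\<^sup>+u. ennreal (exp (c - l)) * indicator A u + ennreal (exp c) * indicator (- A) u \<partial>unif)"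
    using G.emeasure_space_1
    by (intro nn_integral_cong) (auto simp: count_step_def c_def A_def indicator_def)
  also have "\<dots> = ennreal (exp (c - l)) * emeasure unif A + ennreal (exp c) * emeasure unif (- A)"
    using A by (subst nn_integral_add) (auto simp: nn_integral_cmult_indicator)
  also have "\<dots> = ennreal (exp (c - l) * P + exp c * (1 - P))"
    using P by (simp add: EA EcA ennreal_mult'[symmetric] ennreal_plus[symmetric] del: ennreal_plus)
  finally have int: "(\<integral>\<^sup>+x. ennreal (exp (count_step l a q x)) \<partial>round_meas theta) =
    ennreal (exp (c - l) * P + exp c * (1 - P))" .
  have "exp (c - l) * P + exp c * (1 - P) = exp c * (1 - (1 - exp (- l)) * P)"
    by (simp add: exp_diff exp_minus field_simps)
  also have "\<dots> \<le> exp c * exp (- c)"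
  proof (intro mult_left_mono)
    have "c \<le> (1 - exp (- l)) * P" unfolding c_def using P assms(1) by (intro mult_left_mono) auto
    then show "1 - (1 - exp (- l)) * P \<le> exp (- c)" using exp_ge_add_one_self[of "- c"] by linarith
  qed simp
  also have "exp c * exp (- c) = 1" by (simp add: exp_minus)
  finally show ?thesis unfolding int by simp
qed

section \<open>Exponential supermartingales\<close>

lemma state_cong:
  "(\<And>r. r \<le> t \<Longrightarrow> x r = y r) \<Longrightarrow> state F x t = state F y t"
  by (induction t) (simp_all add: Let_def)

context ftas
begin

text \<open>Index \<open>s\<close> belongs to round \<open>Suc s\<close>: the state after
  \<open>s\<close> rounds fixes the law of the next draw.\<close>

abbreviation "q \<omega> s \<equiv> policy F (Suc s) (emp_mean (state F \<omega> s))"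
abbreviation "arm \<omega> s \<equiv> sample (q \<omega> s) (fst (\<omega> (Suc s)))"

text \<open>Measurability of the state enters as a hypothesis so that the lemma can be applied
  inside the induction which proves it.\<close>

lemma measurable_q_aux:
  assumes "\<And>a. (\<lambda>\<omega>. fst (state F \<omega> s) a) \<in> measurable M (count_space UNIV)"
    and "\<And>a. (\<lambda>\<omega>. snd (state F \<omega> s) a) \<in> borel_measurable M"
  shows "(\<lambda>\<omega>. q \<omega> s$a) \<in> borel_measurable M"
proof -
  note [measurable] = assms
  have "(\<lambda>\<omega>. emp_mean (state F \<omega> s)$a) \<in> borel_measurable M" for a
    unfolding emp_mean_def by simp
  then have "(\<lambda>\<omega>. emp_mean (state F \<omega> s) \<bullet> i) \<in> borel_measurable M" if "i \<in> Basis" for i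
    using that by (auto simp: Basis_vec_def inner_axis)
  then have [measurable]: "(\<lambda>\<omega>. emp_mean (state F \<omega> s)) \<in> borel_measurable M"
    by (subst borel_measurable_euclidean_space) auto
  have [measurable]: "wstar F \<in> borel_measurable borel" by (rule measurable_wstar[OF valid])
  have "(\<lambda>v :: (real, 'k) vec. v$a) \<in> borel_measurable borel"
    by (intro borel_measurable_continuous_onI continuous_intros)
  then have [measurable]: "(\<lambda>\<omega>. wstar F (emp_mean (state F \<omega> s))$a) \<in> borel_measurable M"
    by (rule measurable_compose[rotated]) measurable
  show ?thesis unfolding policy_nth by measurable
qed

text \<open>The index set is a parameter because measurability is needed on the finite products,
  where the last round is integrated out, as well as on the full product.\<close>

context
  fixes I :: "nat set" and M
  defines "M \<equiv> PiM I (\<lambda>_. round_meas theta)"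
begin

lemma measurable_round_fst: "t \<in> I \<Longrightarrow> (\<lambda>\<omega>. fst (\<omega> t)) \<in> borel_measurable M"
  using measurable_compose[OF measurable_component_singleton[of t I "\<lambda>_. round_meas theta"] measurable_fst_round]
  by (simp add: M_def)

lemma measurable_round_snd: "t \<in> I \<Longrightarrow> (\<lambda>\<omega>. snd (\<omega> t) a) \<in> borel_measurable M"
  using measurable_compose[OF measurable_component_singleton[of t I "\<lambda>_. round_meas theta"] measurable_snd_round]
  by (simp add: M_def)

lemma measurable_state:
  assumes "{..t} \<subseteq> I"
  shows "(\<lambda>\<omega>. fst (state F \<omega> t) a) \<in> measurable M (count_space UNIV)"
    and "(\<lambda>\<omega>. snd (state F \<omega> t) a) \<in> borel_measurable M"
proof -
  have "(\<forall>a. (\<lambda>\<omega>. fst (state F \<omega> t) a) \<in> measurable M (count_space UNIV)) \<and>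
        (\<forall>a. (\<lambda>\<omega>. snd (state F \<omega> t) a) \<in> borel_measurable M)"
    using assms
  proof (induction t)
    case (Suc t)
    have I: "Suc t \<in> I" and "{..t} \<subseteq> I" using Suc.prems by auto
    then have [measurable]: "\<And>a. (\<lambda>\<omega>. fst (state F \<omega> t) a) \<in> measurable M (count_space UNIV)"
      "\<And>a. (\<lambda>\<omega>. snd (state F \<omega> t) a) \<in> borel_measurable M" using Suc.IH by auto
    note [measurable] = measurable_round_snd[OF I] measurable_round_fst[OF I]
    have [measurable]: "(\<lambda>\<omega>. arm \<omega> t) \<in> measurable M (count_space UNIV)"
      by (intro measurable_sample measurable_q_aux) measurable
    have 1: "fst (state F \<omega> (Suc t)) a = (if arm \<omega> t = a then fst (state F \<omega> t) a + 1 else fst (state F \<omega> t) a)"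
      and 2: "snd (state F \<omega> (Suc t)) a = (if arm \<omega> t = a then snd (state F \<omega> t) a + snd (\<omega> (Suc t)) a else snd (state F \<omega> t) a)" for \<omega> a
      by (auto simp: Let_def)
    show ?case unfolding 1 2 by measurable
  qed simp
  then show "(\<lambda>\<omega>. fst (state F \<omega> t) a) \<in> measurable M (count_space UNIV)"
    and "(\<lambda>\<omega>. snd (state F \<omega> t) a) \<in> borel_measurable M" by auto
qed

lemma measurable_q:
  assumes "{..s} \<subseteq> I"
  shows "(\<lambda>\<omega>. q \<omega> s$a) \<in> borel_measurable M"
  by (intro measurable_q_aux measurable_state[OF assms])

lemma measurable_arm:
  assumes "{..Suc s} \<subseteq> I"
  shows "(\<lambda>\<omega>. arm \<omega> s) \<in> measurable M (count_space UNIV)"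
proof -
  have "{..s} \<subseteq> I" "Suc s \<in> I" using assms by auto
  then show ?thesis by (intro measurable_sample measurable_q measurable_round_fst)
qed

lemma measurable_reward_step:
  assumes "{..Suc s} \<subseteq> I"
  shows "(\<lambda>\<omega>. reward_step l a theta (q \<omega> s) (\<omega> (Suc s))) \<in> borel_measurable M"
proof -
  have "Suc s \<in> I" using assms by auto
  note [measurable] = measurable_arm[OF assms] measurable_round_snd[OF this]
  show ?thesis unfolding reward_step_def by measurable
qed

lemma measurable_count_step:
  assumes "{..Suc s} \<subseteq> I"
  shows "(\<lambda>\<omega>. count_step l a (q \<omega> s) (\<omega> (Suc s))) \<in> borel_measurable M"
proof -
  have "{..s} \<subseteq> I" using assms by auto
  note [measurable] = measurable_arm[OF assms] measurable_q[OF this]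
  show ?thesis unfolding count_step_def by measurable
qed

end

lemma measurable_reward_step_round: "reward_step l a theta p \<in> borel_measurable (round_meas theta)"
proof -
  have [measurable]: "(\<lambda>x. sample p (fst x)) \<in> measurable (round_meas theta) (count_space UNIV)"
    by (intro measurable_sample measurable_fst_round) auto
  note [measurable] = measurable_snd_round[of a theta]
  show ?thesis unfolding reward_step_def by measurable
qed

lemma measurable_count_step_round: "count_step l a p \<in> borel_measurable (round_meas theta)"
proof -
  have [measurable]: "(\<lambda>x. sample p (fst x)) \<in> measurable (round_meas theta) (count_space UNIV)"
    by (intro measurable_sample measurable_fst_round) auto
  show ?thesis unfolding count_step_def by measurable
qed

text \<open>The newest coordinate is integrated out with the earlier ones fixed. These already
  determine the policy, so the newest factor integrates to at most 1. The induction lives on the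
  finite products and is carried to the trajectory space by restricting coordinates.\<close>

lemma exp_supermartingale:
  fixes L :: "(real, 'k) vec \<Rightarrow> real \<times> ('k \<Rightarrow> real) \<Rightarrow> real"
  assumes meas: "\<And>s I. {..Suc s} \<subseteq> I \<Longrightarrow>
      (\<lambda>\<omega>. L (q \<omega> s) (\<omega> (Suc s))) \<in> borel_measurable (PiM I (\<lambda>_. round_meas theta))"
    and meas1: "\<And>p. L p \<in> borel_measurable (round_meas theta)"
    and le1: "\<And>p. p \<in> Sigma_p 0 \<Longrightarrow> (\<integral>\<^sup>+x. ennreal (exp (L p x)) \<partial>round_meas theta) \<le> 1"
  shows "(\<integral>\<^sup>+\<omega>. ennreal (exp (\<Sum>s<t. L (q \<omega> s) (\<omega> (Suc s)))) \<partial>traj_meas theta) \<le> 1"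
proof -
  let ?R = "\<lambda>_::nat. round_meas theta"
  interpret product_prob_space ?R "UNIV :: nat set" by (rule product_prob_round)
  define f where "f t \<omega> = ennreal (exp (\<Sum>s<t. L (q \<omega> s) (\<omega> (Suc s))))" for t \<omega>
  have f[measurable]: "f t \<in> borel_measurable (PiM {..t} ?R)" for t
  proof -
    have "(\<lambda>\<omega>. L (q \<omega> s) (\<omega> (Suc s))) \<in> borel_measurable (PiM {..t} ?R)" if "s \<in> {..<t}" for s
      using that by (intro meas) auto
    then have [measurable]: "(\<lambda>\<omega>. \<Sum>s<t. L (q \<omega> s) (\<omega> (Suc s))) \<in> borel_measurable (PiM {..t} ?R)"
      by (rule borel_measurable_sum)
    show ?thesis unfolding f_def by measurable
  qed
  have fcong: "f t \<omega> = f t \<omega>'" if "\<And>r. r \<le> t \<Longrightarrow> \<omega> r = \<omega>' r" for t \<omega> \<omega>'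
  proof -
    have "L (q \<omega> s) (\<omega> (Suc s)) = L (q \<omega>' s) (\<omega>' (Suc s))" if "s < t" for s
      using state_cong[of s \<omega> \<omega>' F] \<open>\<And>r. r \<le> t \<Longrightarrow> \<omega> r = \<omega>' r\<close> that by simp
    then show ?thesis unfolding f_def by simp
  qed
  have "(\<integral>\<^sup>+\<omega>. f t \<omega> \<partial>PiM {..t} ?R) \<le> 1" for t
  proof (induction t)
    case 0
    have "prob_space (PiM {..0} ?R)" by (intro prob_space_PiM prob_space_round)
    from prob_space.emeasure_space_1[OF this] show ?case by (simp add: f_def)
  next
    case (Suc t)
    have "{..Suc t} = insert (Suc t) {..t}" by auto
    then have "(\<integral>\<^sup>+\<omega>. f (Suc t) \<omega> \<partial>PiM {..Suc t} ?R) =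
        (\<integral>\<^sup>+\<omega>. \<integral>\<^sup>+y. f (Suc t) (fun_upd \<omega> (Suc t) y) \<partial>round_meas theta \<partial>PiM {..t} ?R)"
      using f[of "Suc t"] by (simp add: product_nn_integral_insert)
    also have "\<dots> \<le> (\<integral>\<^sup>+\<omega>. f t \<omega> \<partial>PiM {..t} ?R)"
    proof (intro nn_integral_mono)
      fix \<omega> :: "'k outcome"
      have "f (Suc t) (fun_upd \<omega> (Suc t) y) = f t \<omega> * ennreal (exp (L (q \<omega> t) y))" for y
      proof -
        have "f (Suc t) (fun_upd \<omega> (Suc t) y) = f t (fun_upd \<omega> (Suc t) y) * ennreal (exp (L (q (fun_upd \<omega> (Suc t) y) t) y))"
          by (simp add: f_def exp_add ennreal_mult)
        also have "f t (fun_upd \<omega> (Suc t) y) = f t \<omega>" by (rule fcong) auto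
        also have "state F (fun_upd \<omega> (Suc t) y) t = state F \<omega> t" by (rule state_cong) auto
        finally show ?thesis .
      qed
      then have "(\<integral>\<^sup>+y. f (Suc t) (fun_upd \<omega> (Suc t) y) \<partial>round_meas theta)
          = f t \<omega> * (\<integral>\<^sup>+y. ennreal (exp (L (q \<omega> t) y)) \<partial>round_meas theta)"
        using meas1 by (simp add: nn_integral_cmult)
      also have "\<dots> \<le> f t \<omega> * 1" by (intro mult_left_mono le1 policy_simplex) simp
      finally show "(\<integral>\<^sup>+y. f (Suc t) (fun_upd \<omega> (Suc t) y) \<partial>round_meas theta) \<le> f t \<omega>" by simp
    qed
    finally show ?case using Suc by simp
  qed
  moreover have "(\<integral>\<^sup>+\<omega>. f t \<omega> \<partial>traj_meas theta) = (\<integral>\<^sup>+\<omega>. f t \<omega> \<partial>PiM {..t} ?R)"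
  proof -
    have "PiM {..t} ?R = distr (PiM UNIV ?R) (PiM {..t} ?R) (\<lambda>\<omega>. restrict \<omega> {..t})"
      by (rule distr_PiM_restrict_finite[symmetric]) (auto intro: prob_space_round)
    then have "(\<integral>\<^sup>+\<omega>. f t \<omega> \<partial>PiM {..t} ?R) =
        (\<integral>\<^sup>+\<omega>. f t \<omega> \<partial>distr (PiM UNIV ?R) (PiM {..t} ?R) (\<lambda>\<omega>. restrict \<omega> {..t}))" by metis
    also have "\<dots> = (\<integral>\<^sup>+\<omega>. f t (restrict \<omega> {..t}) \<partial>PiM UNIV ?R)"
      by (intro nn_integral_distr measurable_restrict_subset f) auto
    also have "\<dots> = (\<integral>\<^sup>+\<omega>. f t \<omega> \<partial>traj_meas theta)"
      unfolding traj_meas_def by (intro nn_integral_cong fcong) auto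
    finally show ?thesis by simp
  qed
  ultimately show ?thesis by (simp add: f_def)
qed

section \<open>Counts, rewards and their exponential tails\<close>

abbreviation "N \<omega> t a \<equiv> fst (state F \<omega> t) a"
abbreviation "R \<omega> t a \<equiv> snd (state F \<omega> t) a"
text \<open>The predictable compensator of the count \<open>N\<close>.\<close>

abbreviation "S \<omega> t a \<equiv> (\<Sum>s<t. q \<omega> s$a)"

lemma sum_count_step:
  "(\<Sum>s<t. count_step l a (q \<omega> s) (\<omega> (Suc s))) = (1 - exp (- l)) * S \<omega> t a - l * real (N \<omega> t a)"
proof (induction t)
  case (Suc t)
  have "N \<omega> (Suc t) a = N \<omega> t a + (if arm \<omega> t = a then 1 else 0)" by (simp add: Let_def)
  then show ?case using Suc unfolding count_step_def by (simp add: algebra_simps del: state.simps)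
qed simp

lemma sum_reward_step:
  "(\<Sum>s<t. reward_step l a theta (q \<omega> s) (\<omega> (Suc s)))
    = l * (R \<omega> t a - theta$a * real (N \<omega> t a)) - l\<^sup>2 / 2 * real (N \<omega> t a)"
proof (induction t)
  case (Suc t)
  have "N \<omega> (Suc t) a = N \<omega> t a + (if arm \<omega> t = a then 1 else 0)"
    "R \<omega> (Suc t) a = R \<omega> t a + (if arm \<omega> t = a then snd (\<omega> (Suc t)) a else 0)"
    by (simp_all add: Let_def)
  then show ?case using Suc unfolding reward_step_def by (simp add: algebra_simps del: state.simps)
qed simp

lemma prob_space_traj: "prob_space (traj_meas theta)"
  unfolding traj_meas_def by (intro prob_space_PiM prob_space_round)

lemma space_traj: "space (traj_meas theta) = UNIV"
  by (simp add: traj_meas_def space_PiM round_meas_def space_pair_measure)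

lemma measurable_traj [measurable]:
  "(\<lambda>\<omega>. N \<omega> t a) \<in> measurable (traj_meas theta) (count_space UNIV)"
  "(\<lambda>\<omega>. R \<omega> t a) \<in> borel_measurable (traj_meas theta)"
  "(\<lambda>\<omega>. q \<omega> t$a) \<in> borel_measurable (traj_meas theta)"
  unfolding traj_meas_def by (intro measurable_state measurable_q; simp)+

lemma exp_tail_bound:
  assumes X: "X \<in> borel_measurable (traj_meas theta)"
    and E: "(\<integral>\<^sup>+\<omega>. ennreal (exp (X \<omega>)) \<partial>traj_meas theta) \<le> 1"
    and B: "B \<in> sets (traj_meas theta)" "\<And>\<omega>. \<omega> \<in> B \<Longrightarrow> x \<le> X \<omega>"
  shows "emeasure (traj_meas theta) B \<le> ennreal (exp (- x))"
proof -
  have "emeasure (traj_meas theta) B = (\<integral>\<^sup>+\<omega>. indicator B \<omega> \<partial>traj_meas theta)" using B by simp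
  also have "\<dots> \<le> (\<integral>\<^sup>+\<omega>. ennreal (exp (- x)) * ennreal (exp (X \<omega>)) \<partial>traj_meas theta)"
  proof (intro nn_integral_mono)
    fix \<omega>
    have "1 \<le> ennreal (exp (- x)) * ennreal (exp (X \<omega>))" if "\<omega> \<in> B"
      using B(2)[OF that] by (simp add: ennreal_mult'[symmetric] exp_add[symmetric])
    then show "indicator B \<omega> \<le> ennreal (exp (- x)) * ennreal (exp (X \<omega>))"
      by (auto simp: indicator_def)
  qed
  also have "\<dots> = ennreal (exp (- x)) * (\<integral>\<^sup>+\<omega>. ennreal (exp (X \<omega>)) \<partial>traj_meas theta)"
    using X by (intro nn_integral_cmult) measurable
  also have "\<dots> \<le> ennreal (exp (- x)) * 1" using E by (intro mult_left_mono) auto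
  finally show ?thesis by simp
qed

lemma count_tail:
  assumes "0 \<le> l" "B \<in> sets (traj_meas theta)"
    and "\<And>\<omega>. \<omega> \<in> B \<Longrightarrow> x \<le> (1 - exp (- l)) * S \<omega> t a - l * real (N \<omega> t a)"
  shows "emeasure (traj_meas theta) B \<le> ennreal (exp (- x))"
proof (rule exp_tail_bound[OF _ _ assms(2,3)])
  show "(\<lambda>\<omega>. (1 - exp (- l)) * S \<omega> t a - l * real (N \<omega> t a)) \<in> borel_measurable (traj_meas theta)"
    by measurable
  show "(\<integral>\<^sup>+\<omega>. ennreal (exp ((1 - exp (- l)) * S \<omega> t a - l * real (N \<omega> t a))) \<partial>traj_meas theta) \<le> 1"
    using exp_supermartingale[of "count_step l a" t] assms(1)
    by (simp add: sum_count_step measurable_count_step measurable_count_step_round count_step_integral)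
qed

lemma reward_tail:
  assumes "B \<in> sets (traj_meas theta)"
    and "\<And>\<omega>. \<omega> \<in> B \<Longrightarrow> x \<le> l * (R \<omega> t a - theta$a * real (N \<omega> t a)) - l\<^sup>2 / 2 * real (N \<omega> t a)"
  shows "emeasure (traj_meas theta) B \<le> ennreal (exp (- x))"
proof (rule exp_tail_bound[OF _ _ assms])
  show "(\<lambda>\<omega>. l * (R \<omega> t a - theta$a * real (N \<omega> t a)) - l\<^sup>2 / 2 * real (N \<omega> t a)) \<in> borel_measurable (traj_meas theta)"
    by measurable
  show "(\<integral>\<^sup>+\<omega>. ennreal (exp (l * (R \<omega> t a - theta$a * real (N \<omega> t a)) - l\<^sup>2 / 2 * real (N \<omega> t a))) \<partial>traj_meas theta) \<le> 1"
    using exp_supermartingale[of "reward_step l a theta" t]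
    by (simp add: sum_reward_step measurable_reward_step measurable_reward_step_round reward_step_integral)
qed

end

section \<open>Concentration after an integrable time\<close>

context ftas
begin

section \<open>Bad events and their probabilities\<close>

definition pmin :: real where "pmin = Min (range (\<lambda>a. pic F$a))"

lemma pmin_pos: "0 < pmin"
  unfolding pmin_def by (subst Min_gr_iff) (auto intro: pic_pos)

lemma pmin_le: "pmin \<le> pic F$a"
  unfolding pmin_def by (intro Min_le) auto

lemma S_ge: "pmin * sqrt (real t) / 2 \<le> S \<omega> t a"
proof -
  have "pmin * (sqrt (real t) / 2) \<le> pmin * (\<Sum>s<t. eps (Suc s))"
    using pmin_pos sum_eps(1) by (intro mult_left_mono) auto
  also have "\<dots> = (\<Sum>s<t. eps (Suc s) * pmin)" by (simp add: sum_distrib_left mult.commute)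
  also have "\<dots> \<le> S \<omega> t a"
  proof (rule sum_mono)
    fix s
    have "eps (Suc s) * pmin \<le> eps (Suc s) * pic F$a"
      using eps_bounds[of s] pmin_le by (intro mult_left_mono) auto
    then show "eps (Suc s) * pmin \<le> q \<omega> s$a" using policy_ge_forced order_trans by blast
  qed
  finally show ?thesis by simp
qed

lemma S_le: "S \<omega> t a \<le> real t"
proof -
  have "S \<omega> t a \<le> (\<Sum>s<t. 1)"
    by (rule sum_mono) (use policy_simplex in \<open>auto simp: Sigma_p_def\<close>)
  then show ?thesis by simp
qed

lemma S_nonneg: "0 \<le> S \<omega> t a"
  by (rule sum_nonneg) (rule Sigma_p_nonneg[OF policy_simplex])

text \<open>The 1/8: by \<open>S_ge\<close> the compensator is at least pmin * sqrt t / 2, the tilt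
  1 keeps at least half of it because 1 - exp (- 1) \<ge> 1/2, and half of the remaining pmin * sqrt
  t / 4 is spent on the exponent.\<close>

definition few :: "nat \<Rightarrow> 'k \<Rightarrow> 'k outcome set" where
  "few t a = {\<omega>. real (N \<omega> t a) \<le> pmin / 8 * sqrt (real t)}"

text \<open>The values 1 and -1 of \<open>l\<close> give the two signs of the deviation. The lower
  bound on the count is part of the event because the exponent of \<open>reward_tail\<close> is
  proportional to the count.\<close>

definition off :: "real \<Rightarrow> real \<Rightarrow> nat \<Rightarrow> 'k \<Rightarrow> 'k outcome set" where
  "off l e t a = {\<omega>. pmin / 8 * sqrt (real t) \<le> real (N \<omega> t a) \<and>
     e * real (N \<omega> t a) \<le> l * (R \<omega> t a - theta$a * real (N \<omega> t a))}"

definition lag :: "real \<Rightarrow> nat \<Rightarrow> 'k \<Rightarrow> 'k outcome set" where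
  "lag e t a = {\<omega>. real (N \<omega> t a) + e * real t \<le> S \<omega> t a}"

lemma sets_bad:
  "few t a \<in> sets (traj_meas theta)" "off l e t a \<in> sets (traj_meas theta)" "lag e t a \<in> sets (traj_meas theta)"
proof -
  have "{\<omega> \<in> space (traj_meas theta). real (N \<omega> t a) \<le> pmin / 8 * sqrt (real t)} \<in> sets (traj_meas theta)"
    by measurable
  then show "few t a \<in> sets (traj_meas theta)" by (simp add: few_def space_traj)
  have "{\<omega> \<in> space (traj_meas theta). pmin / 8 * sqrt (real t) \<le> real (N \<omega> t a) \<and>
     e * real (N \<omega> t a) \<le> l * (R \<omega> t a - theta$a * real (N \<omega> t a))} \<in> sets (traj_meas theta)"
    by (intro sets.sets_Collect_conj borel_measurable_le borel_measurable_times borel_measurable_diff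
        borel_measurable_const measurable_traj(2) measurable_compose[OF measurable_traj(1)]) simp_all
  then show "off l e t a \<in> sets (traj_meas theta)" by (simp add: off_def space_traj)
  have "{\<omega> \<in> space (traj_meas theta). real (N \<omega> t a) + e * real t \<le> S \<omega> t a} \<in> sets (traj_meas theta)"
    by measurable
  then show "lag e t a \<in> sets (traj_meas theta)" by (simp add: lag_def space_traj)
qed

lemma few_tail: "emeasure (traj_meas theta) (few t a) \<le> ennreal (exp (- (pmin / 8 * sqrt (real t))))"
proof (rule count_tail[of 1])
  fix \<omega> assume "\<omega> \<in> few t a"
  then have n: "real (N \<omega> t a) \<le> pmin / 8 * sqrt (real t)" by (simp add: few_def)
  have "2 \<le> exp (1::real)" using exp_ge_add_one_self[of 1] by simp
  then have "exp (- 1 :: real) \<le> 1 / 2" by (simp add: exp_minus field_simps)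
  then have "1 / 2 * S \<omega> t a \<le> (1 - exp (- 1)) * S \<omega> t a"
    using S_nonneg by (intro mult_right_mono) auto
  then show "pmin / 8 * sqrt (real t) \<le> (1 - exp (- 1)) * S \<omega> t a - 1 * real (N \<omega> t a)"
    using S_ge[of t \<omega> a] n by (simp add: field_simps)
qed (use sets_bad in auto)

lemma off_tail:
  assumes "0 < e" "l = 1 \<or> l = -1"
  shows "emeasure (traj_meas theta) (off l e t a) \<le> ennreal (exp (- (e\<^sup>2 / 2 * (pmin / 8 * sqrt (real t)))))"
\<comment> \<open>The tilt of size \<open>e\<close> is the best one: e * e - e^2 / 2 = e^2 / 2 per
  draw.\<close>
proof (rule reward_tail[of _ _ "l * e"])
  fix \<omega> assume "\<omega> \<in> off l e t a"
  then have n: "pmin / 8 * sqrt (real t) \<le> real (N \<omega> t a)"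
    and r: "e * real (N \<omega> t a) \<le> l * (R \<omega> t a - theta$a * real (N \<omega> t a))" by (auto simp: off_def)
  have l: "(l * e)\<^sup>2 = e\<^sup>2" using assms(2) by auto
  have "e\<^sup>2 / 2 * (pmin / 8 * sqrt (real t)) \<le> e\<^sup>2 / 2 * real (N \<omega> t a)"
    using n by (intro mult_left_mono) auto
  moreover have "e * (e * real (N \<omega> t a)) \<le> e * (l * (R \<omega> t a - theta$a * real (N \<omega> t a)))"
    using r assms(1) by (intro mult_left_mono) auto
  ultimately show "e\<^sup>2 / 2 * (pmin / 8 * sqrt (real t)) \<le>
      l * e * (R \<omega> t a - theta$a * real (N \<omega> t a)) - (l * e)\<^sup>2 / 2 * real (N \<omega> t a)"
    unfolding l by (simp add: power2_eq_square algebra_simps)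
qed (use sets_bad in auto)

lemma lag_tail:
  assumes "0 < e"
  shows "emeasure (traj_meas theta) (lag e t a) \<le> ennreal (exp (- (e\<^sup>2 / 4 * sqrt (real t))))"
\<comment> \<open>Since 1 - exp (- l) \<ge> l - l^2, a deficit of e * t gives an exponent of at
  least (l * e - l^2) * t, which is largest at l = e / 2. It is then weakened to sqrt t to match the
  other events.\<close>
proof (rule count_tail[of "e / 2"])
  fix \<omega> assume "\<omega> \<in> lag e t a"
  then have n: "real (N \<omega> t a) + e * real t \<le> S \<omega> t a" by (simp add: lag_def)
  define l where "l = e / 2"
  have l: "0 < l" "e = 2 * l" using assms by (auto simp: l_def)
  have "exp (- l) \<le> 1 / (1 + l)"
    using exp_ge_add_one_self[of l] l by (simp add: exp_minus field_simps)
  also have "\<dots> \<le> 1 - l + l\<^sup>2"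
  proof -
    have "1 \<le> (1 - l + l\<^sup>2) * (1 + l)" using l by (simp add: power2_eq_square algebra_simps)
    then show ?thesis using l by (simp add: pos_divide_le_eq)
  qed
  finally have "(l - l\<^sup>2) * S \<omega> t a \<le> (1 - exp (- l)) * S \<omega> t a"
    using S_nonneg by (intro mult_right_mono) auto
  moreover have "l\<^sup>2 * S \<omega> t a \<le> l\<^sup>2 * real t" using S_le by (intro mult_left_mono) auto
  moreover have "l * (real (N \<omega> t a) + e * real t) \<le> l * S \<omega> t a" using n l by (intro mult_left_mono) auto
  ultimately have 1: "l\<^sup>2 * real t \<le> (1 - exp (- l)) * S \<omega> t a - l * real (N \<omega> t a)"
    unfolding l(2) by (simp add: power2_eq_square algebra_simps)
  have "sqrt (real t) \<le> real t"
    by (rule real_le_lsqrt) (simp_all add: power2_eq_square le_square flip: of_nat_mult)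
  then have 2: "l\<^sup>2 * sqrt (real t) \<le> l\<^sup>2 * real t" by (intro mult_left_mono) auto
  have 3: "e\<^sup>2 / 4 = l\<^sup>2" unfolding l(2) by (simp add: power2_eq_square)
  show "e\<^sup>2 / 4 * sqrt (real t) \<le> (1 - exp (- (e / 2))) * S \<omega> t a - e / 2 * real (N \<omega> t a)"
    unfolding l_def[symmetric] 3 by (rule order_trans[OF 2 1])
qed (use sets_bad assms in auto)

section \<open>An integrable bound for the last bad round\<close>

definition bad :: "real \<Rightarrow> nat \<Rightarrow> 'k outcome set" where
  "bad e t = (\<Union>a. few t a \<union> off 1 e t a \<union> off (-1) e t a \<union> lag e t a)"

lemma sets_bad_Un: "bad e t \<in> sets (traj_meas theta)"
  unfolding bad_def by (intro sets.finite_UN sets.Un sets_bad) auto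

lemma bad_tail:
  assumes "0 < e"
  obtains k where "0 < k"
    "\<And>t. emeasure (traj_meas theta) (bad e t) \<le> ennreal (4 * real CARD('k) * exp (- (k * sqrt (real t))))"
proof
  define k where "k = min (pmin / 8) (min (e\<^sup>2 / 2 * (pmin / 8)) (e\<^sup>2 / 4))"
  show "0 < k" using pmin_pos assms by (simp add: k_def)
  fix t
  define x where "x = ennreal (exp (- (k * sqrt (real t))))"
  have mono: "ennreal (exp (- (k' * sqrt (real t)))) \<le> x" if "k \<le> k'" for k'
    unfolding x_def using that by (intro ennreal_leI) (simp add: mult_right_mono)
  have le: "emeasure (traj_meas theta) (few t a) \<le> x" "emeasure (traj_meas theta) (off 1 e t a) \<le> x"
    "emeasure (traj_meas theta) (off (-1) e t a) \<le> x" "emeasure (traj_meas theta) (lag e t a) \<le> x" for a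
  proof -
    show "emeasure (traj_meas theta) (few t a) \<le> x"
      by (rule order_trans[OF few_tail mono]) (simp add: k_def)
    have k2: "k \<le> e\<^sup>2 / 2 * (pmin / 8)" by (simp add: k_def)
    show "emeasure (traj_meas theta) (off 1 e t a) \<le> x"
      using order_trans[OF off_tail[OF assms, of 1] mono[OF k2, simplified mult.assoc]] by simp
    show "emeasure (traj_meas theta) (off (-1) e t a) \<le> x"
      using order_trans[OF off_tail[OF assms, of "-1"] mono[OF k2, simplified mult.assoc]] by simp
    show "emeasure (traj_meas theta) (lag e t a) \<le> x"
      by (rule order_trans[OF lag_tail[OF assms] mono]) (simp add: k_def)
  qed
  have "emeasure (traj_meas theta) (few t a \<union> off 1 e t a \<union> off (-1) e t a \<union> lag e t a) \<le> x + x + x + x" for a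
    by (intro order_trans[OF emeasure_subadditive] add_mono le sets.Un sets_bad)
  then have "emeasure (traj_meas theta) (bad e t) \<le> (\<Sum>a\<in>(UNIV::'k set). x + x + x + x)"
    unfolding bad_def
    by (intro order_trans[OF emeasure_subadditive_finite] sum_mono) (auto intro!: sets.Un sets_bad)
  also have "\<dots> = ennreal (4 * real CARD('k) * exp (- (k * sqrt (real t))))"
  proof -
    have "x + x + x + x = ennreal (4 * exp (- (k * sqrt (real t))))"
      unfolding x_def by (simp add: ennreal_plus[symmetric] del: ennreal_plus)
    then show ?thesis by (simp add: ennreal_of_nat_eq_real_of_nat ennreal_mult'[symmetric] mult_ac)
  qed
  finally show "emeasure (traj_meas theta) (bad e t) \<le> ennreal (4 * real CARD('k) * exp (- (k * sqrt (real t))))" .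
qed

text \<open>The sum of all bad rounds dominates the last one, and its expectation is immediate.\<close>

definition last_bad :: "real \<Rightarrow> 'k outcome \<Rightarrow> ennreal" where
  "last_bad e \<omega> = (\<Sum>t. of_nat t * indicator (bad e t) \<omega>)"

lemma measurable_last_bad [measurable]: "last_bad e \<in> borel_measurable (traj_meas theta)"
proof -
  note [measurable] = sets_bad_Un
  show ?thesis unfolding last_bad_def by measurable
qed

lemma last_bad_integrable:
  assumes "0 < e"
  shows "(\<integral>\<^sup>+\<omega>. last_bad e \<omega> \<partial>traj_meas theta) < \<infinity>"
proof -
  obtain k where k: "0 < k"
    "\<And>t. emeasure (traj_meas theta) (bad e t) \<le> ennreal (4 * real CARD('k) * exp (- (k * sqrt (real t))))"
    using bad_tail[OF assms] by blast
  define f where "f t = real t * (4 * real CARD('k) * exp (- (k * sqrt (real t))))" for t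
  have "(\<lambda>t. real t * exp (- (k * sqrt (real t)))) \<in> O(\<lambda>t. inverse (real t ^ 2))"
    using k(1) by real_asymp
  then have "summable (\<lambda>t. real t * exp (- (k * sqrt (real t))))"
    by (rule summable_comparison_test_bigo[rotated]) (use inverse_power_summable[of 2] in \<open>simp add: norm_inverse norm_power\<close>)
  then have "summable (\<lambda>t. (4 * real CARD('k)) * (real t * exp (- (k * sqrt (real t)))))"
    by (rule summable_mult)
  then have f: "summable f" unfolding f_def[abs_def] by (simp add: mult_ac)
  have "(\<integral>\<^sup>+\<omega>. last_bad e \<omega> \<partial>traj_meas theta) = (\<Sum>t. of_nat t * emeasure (traj_meas theta) (bad e t))"
    unfolding last_bad_def using sets_bad_Un
    by (subst nn_integral_suminf) (auto simp: nn_integral_cmult_indicator)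
  also have "\<dots> \<le> (\<Sum>t. ennreal (f t))"
  proof (intro suminf_le)
    fix t
    have "of_nat t * emeasure (traj_meas theta) (bad e t)
        \<le> ennreal (real t) * ennreal (4 * real CARD('k) * exp (- (k * sqrt (real t))))"
      using k(2)[of t] by (simp add: ennreal_of_nat_eq_real_of_nat mult_left_mono)
    then show "of_nat t * emeasure (traj_meas theta) (bad e t) \<le> ennreal (f t)"
      by (simp add: f_def ennreal_mult'[symmetric])
  qed auto
  also have "\<dots> = ennreal (suminf f)"
    by (rule suminf_ennreal2[OF _ f]) (simp add: f_def)
  also have "\<dots> < \<infinity>" by simp
  finally show ?thesis .
qed

lemma last_bad_ge: "\<omega> \<in> bad e t \<Longrightarrow> of_nat t \<le> last_bad e \<omega>"
  using sum_le_suminf[of "\<lambda>t. of_nat t * indicator (bad e t) \<omega> :: ennreal" "{t}"]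
  by (simp add: last_bad_def)

lemma not_bad:
  assumes "\<omega> \<notin> bad e t"
  shows "pmin / 8 * sqrt (real t) < real (N \<omega> t a)" "0 < N \<omega> t a"
    "\<bar>emp_mean (state F \<omega> t)$a - theta$a\<bar> < e" "S \<omega> t a - e * real t \<le> real (N \<omega> t a)"
proof -
  have na: "\<omega> \<notin> few t a" "\<omega> \<notin> off 1 e t a" "\<omega> \<notin> off (-1) e t a" "\<omega> \<notin> lag e t a"
    using assms by (auto simp: bad_def)
  show n: "pmin / 8 * sqrt (real t) < real (N \<omega> t a)" using na by (simp add: few_def)
  have "0 \<le> pmin / 8 * sqrt (real t)" using pmin_pos by simp
  then show n0: "0 < N \<omega> t a" using n by (metis of_nat_0_less_iff le_less_trans)
  \<comment> \<open>Outside \<open>few\<close> the first condition of \<open>off\<close> holds, so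
    its second condition must fail, for both signs.\<close>
  have "R \<omega> t a - theta$a * real (N \<omega> t a) < e * real (N \<omega> t a)"
    "- (R \<omega> t a - theta$a * real (N \<omega> t a)) < e * real (N \<omega> t a)"
    using na n by (auto simp: off_def)
  moreover have "emp_mean (state F \<omega> t)$a - theta$a = (R \<omega> t a - theta$a * real (N \<omega> t a)) / real (N \<omega> t a)"
    using n0 by (simp add: emp_mean_def diff_divide_distrib)
  ultimately show "\<bar>emp_mean (state F \<omega> t)$a - theta$a\<bar> < e"
    using n0 by (simp add: abs_less_iff pos_divide_less_eq minus_divide_left del: minus_diff_eq)
  show "S \<omega> t a - e * real t \<le> real (N \<omega> t a)" using na by (simp add: lag_def)
qed

section \<open>Tracking of the optimal weights\<close>

text \<open>Continuity of \<open>wstar\<close> in coordinates. \<open>d\<close> is required to be at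
  most \<open>e\<close> because it also serves as the accuracy in \<open>bad\<close>.\<close>

lemma wstar_near:
  assumes "0 < e"
  obtains d where "0 < d" "d \<le> e"
    "\<And>lam a. (\<And>b. \<bar>lam$b - theta$b\<bar> < d) \<Longrightarrow> wstar F theta$a - e \<le> wstar F lam$a"
proof -
  have "isCont (wstar F) theta"
    using continuous_on_interior[OF continuous_on_wstar[OF valid], of theta] uniq
    by (simp add: interior_open[OF open_uniq_best])
  then obtain r where r: "0 < r" "\<And>lam. dist lam theta < r \<Longrightarrow> dist (wstar F lam) (wstar F theta) < e"
    using assms unfolding continuous_at_eps_delta by metis
  define d where "d = min e (r / real CARD('k))"
  have C: "0 < real CARD('k)" by simp
  show ?thesis
  proof
    show "0 < d" "d \<le> e" using assms r(1) by (auto simp: d_def)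
    fix lam :: "(real, 'k) vec" and a
    assume lam: "\<And>b. \<bar>lam$b - theta$b\<bar> < d"
    have "norm (lam - theta) \<le> (\<Sum>b\<in>UNIV. \<bar>(lam - theta)$b\<bar>)" by (rule norm_le_l1_cart)
    also have "\<dots> < (\<Sum>b\<in>(UNIV::'k set). d)" using lam by (intro sum_strict_mono) auto
    also have "\<dots> = real CARD('k) * d" by simp
    also have "\<dots> \<le> r"
      using mult_left_mono[of d "r / real CARD('k)" "real CARD('k)"] by (simp add: d_def)
    finally have "norm (wstar F lam - wstar F theta) < e" using r(2)[of lam] by (simp add: dist_norm)
    then have "\<bar>(wstar F lam - wstar F theta)$a\<bar> < e"
      using component_le_norm_cart[of "wstar F lam - wstar F theta" a] by linarith
    then show "wstar F theta$a - e \<le> wstar F lam$a" by simp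
  qed
qed

text \<open>Four losses against t times the optimal weight: \<open>e\<close> per round from the
  estimated parameter, at most 1 for each of the first \<open>m\<close> rounds, sqrt t for
  exploration, and d * t \<le> e * t for the distance between \<open>N\<close> and its
  compensator.\<close>

lemma count_ge:
  assumes "0 < e" "d \<le> e" "\<And>s. m \<le> s \<Longrightarrow> \<omega> \<notin> bad d s"
    and near: "\<And>lam a. (\<And>b. \<bar>lam$b - theta$b\<bar> < d) \<Longrightarrow> wstar F theta$a - e \<le> wstar F lam$a"
    and "m \<le> t"
  shows "real t * (wstar F theta$a - 2 * e) - real m - sqrt (real t) \<le> real (N \<omega> t a)"
proof -
  have w: "wstar F theta$a \<le> 1" using wstar_in_simplex by (auto simp: Sigma_p_def)
  have q: "wstar F theta$a - e - (if s < m then 1 else 0) - eps (Suc s) \<le> q \<omega> s$a" for s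
  proof -
    have "wstar F theta$a - e - (if s < m then 1 else 0) \<le> wstar F (emp_mean (state F \<omega> s))$a"
    proof (cases "s < m")
      case True
      then show ?thesis using w assms(1) Sigma_p_nonneg[OF wstar_in_simplex, of "emp_mean (state F \<omega> s)" a] by simp
    next
      case False
      then show ?thesis using near not_bad(3)[OF assms(3)] by simp
    qed
    then show ?thesis using policy_ge_wstar[of "emp_mean (state F \<omega> s)" a s] by linarith
  qed
  have "(\<Sum>s<t. wstar F theta$a - e - (if s < m then 1 else 0) - eps (Suc s)) \<le> S \<omega> t a"
    by (rule sum_mono) (rule q)
  also have "(\<Sum>s<t. wstar F theta$a - e - (if s < m then 1 else 0) - eps (Suc s)) =
      real t * (wstar F theta$a - e) - (\<Sum>s<t. if s < m then 1 else 0) - (\<Sum>s<t. eps (Suc s))"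
    by (simp add: sum_subtractf)
  also have "(\<Sum>s<t. if s < m then 1 else 0) = real m"
  proof -
    have "{..<t} \<inter> {s. s < m} = {..<m}" using assms(5) by auto
    then show ?thesis by (simp add: sum.If_cases)
  qed
  finally have "real t * (wstar F theta$a - e) - real m - sqrt (real t) \<le> S \<omega> t a"
    using sum_eps(2)[of t] by linarith
  moreover have "d * real t \<le> e * real t" using assms(2) by (intro mult_right_mono) auto
  ultimately show ?thesis using not_bad(4)[OF assms(3)[OF assms(5)], of a]
    by (simp add: algebra_simps)
qed

text \<open>\<open>M\<close> may take the value infinity, where the four claims are void;
  integrability makes this a null event.\<close>

lemma concentration:
  assumes "0 < e"
  obtains M where "M \<in> borel_measurable (traj_meas theta)" "(\<integral>\<^sup>+\<omega>. M \<omega> \<partial>traj_meas theta) < \<infinity>"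
    "\<And>\<omega> t a. M \<omega> \<le> of_nat t \<Longrightarrow> 0 < N \<omega> t a"
    "\<And>\<omega> t a. M \<omega> \<le> of_nat t \<Longrightarrow> pmin / 8 * sqrt (real t) \<le> real (N \<omega> t a)"
    "\<And>\<omega> t a. M \<omega> \<le> of_nat t \<Longrightarrow> \<bar>emp_mean (state F \<omega> t)$a - theta$a\<bar> < e"
    "\<And>\<omega> t a. M \<omega> \<le> of_nat t \<Longrightarrow> real t * (wstar F theta$a - e) \<le> real (N \<omega> t a)"
proof -
  \<comment> \<open>\<open>count_ge\<close> loses 2 * h per round, and the terms m and sqrt t will
    cost at most h * t each.\<close>
  define h where "h = e / 4"
  have h: "0 < h" "e = 4 * h" using assms by (auto simp: h_def)
  obtain d where d: "0 < d" "d \<le> h"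
    "\<And>lam a. (\<And>b. \<bar>lam$b - theta$b\<bar> < d) \<Longrightarrow> wstar F theta$a - h \<le> wstar F lam$a"
    using wstar_near[OF h(1)] by blast
  define r where "r = nat \<lceil>1 / h\<rceil> + 1"
  have r: "1 / h \<le> real r" "1 \<le> r" unfolding r_def by linarith+
  \<comment> \<open>With r \<ge> 1 / h and b the value of \<open>last_bad d\<close>, M \<le> t gives
    r * (b + 2) \<le> t, hence b + 2 \<le> h * t, and r * r \<le> t, hence sqrt t \<le> h * t. The 2
    pays for rounding b up to an index strictly beyond all bad rounds.\<close>
  define M where "M \<omega> = of_nat r * (last_bad d \<omega> + 2) + of_nat (r * r)" for \<omega>
  interpret P: prob_space "traj_meas theta" by (rule prob_space_traj)
  have M[measurable]: "M \<in> borel_measurable (traj_meas theta)" unfolding M_def[abs_def] by measurable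
  have "(\<integral>\<^sup>+\<omega>. M \<omega> \<partial>traj_meas theta) = of_nat r * ((\<integral>\<^sup>+\<omega>. last_bad d \<omega> \<partial>traj_meas theta) + 2) + of_nat (r * r)"
    unfolding M_def by (simp add: nn_integral_add nn_integral_cmult P.emeasure_space_1)
  then have IM: "(\<integral>\<^sup>+\<omega>. M \<omega> \<partial>traj_meas theta) < \<infinity>"
    using last_bad_integrable[OF d(1)] by (simp add: ennreal_mult_less_top of_nat_less_top)
  have key: "\<exists>m. m \<le> t \<and> real m \<le> h * real t \<and> sqrt (real t) \<le> h * real t \<and> (\<forall>s\<ge>m. \<omega> \<notin> bad d s)"
    if Mt: "M \<omega> \<le> of_nat t" for \<omega> t
  proof -
    have "last_bad d \<omega> \<noteq> \<infinity>"
      using Mt r(2) by (auto simp: M_def ennreal_mult_top top_unique)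
    then obtain b where b: "last_bad d \<omega> = ennreal b" "0 \<le> b" by (cases "last_bad d \<omega>") auto
    have "M \<omega> = ennreal (real r * (b + 2) + real (r * r))"
      using b(2) unfolding M_def b
      by (simp add: ennreal_of_nat_eq_real_of_nat ennreal_mult'[symmetric] ennreal_plus[symmetric] ennreal_numeral[symmetric] del: ennreal_plus ennreal_numeral)
    then have bt: "real r * (b + 2) + real r * real r \<le> real t"
      using Mt by (simp add: ennreal_of_nat_eq_real_of_nat)
    have rb: "real r * (b + 2) \<le> real t" by (rule order_trans[OF _ bt]) simp
    have rr: "real r * real r \<le> real t" by (rule order_trans[OF _ bt]) (use b(2) in simp)
    define m where "m = nat \<lceil>b\<rceil> + 1"
    have m: "b < real m" "real m \<le> b + 2" unfolding m_def using b(2) by linarith+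
    have "1 * (b + 2) \<le> real r * (b + 2)" using r(2) b(2) by (intro mult_right_mono) auto
    with m(2) have "real m \<le> real r * (b + 2)" by (metis mult_1 order_trans)
    then have mt: "real m \<le> real t" using rb by (rule order_trans)
    have hr: "1 \<le> h * real r" using r(1) h(1) by (simp add: pos_divide_le_eq mult.commute)
    have "1 * (b + 2) \<le> (h * real r) * (b + 2)" using hr b(2) by (intro mult_right_mono) auto
    with m(2) have "real m \<le> (h * real r) * (b + 2)" by (metis mult_1 order_trans)
    also have "\<dots> = h * (real r * (b + 2))" by simp
    also have "\<dots> \<le> h * real t" using rb h(1) by (intro mult_left_mono) auto
    finally have 1: "real m \<le> h * real t" .
    have "real r \<le> sqrt (real t)" using rr by (simp add: real_le_rsqrt power2_eq_square)
    then have "1 \<le> h * sqrt (real t)" using hr h(1) by (meson mult_left_mono less_imp_le order_trans)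
    then have "1 * sqrt (real t) \<le> h * sqrt (real t) * sqrt (real t)" by (intro mult_right_mono) auto
    then have 2: "sqrt (real t) \<le> h * real t" by (simp add: mult.assoc)
    have "\<omega> \<notin> bad d s" if "m \<le> s" for s
    proof
      assume "\<omega> \<in> bad d s"
      then have "ennreal (real s) \<le> ennreal b" using last_bad_ge b by (metis ennreal_of_nat_eq_real_of_nat)
      then have "real s \<le> b" using b(2) by simp
      then show False using that m(1) by linarith
    qed
    then show ?thesis using mt 1 2 by auto
  qed
  show ?thesis
  proof (rule that[OF M IM])
    fix \<omega> t a assume "M \<omega> \<le> of_nat t"
    from key[OF this] obtain m where m: "m \<le> t" "real m \<le> h * real t" "sqrt (real t) \<le> h * real t"
      "\<And>s. m \<le> s \<Longrightarrow> \<omega> \<notin> bad d s" by blast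
    show "0 < N \<omega> t a" "pmin / 8 * sqrt (real t) \<le> real (N \<omega> t a)"
      using not_bad(1,2)[OF m(4)[OF m(1)]] by (auto simp: less_imp_le)
    show "\<bar>emp_mean (state F \<omega> t)$a - theta$a\<bar> < e"
      using not_bad(3)[OF m(4)[OF m(1)], of a] d(2) h by linarith
    show "real t * (wstar F theta$a - e) \<le> real (N \<omega> t a)"
      using count_ge[OF h(1) d(2) m(4) d(3) m(1), of a] m(2,3) unfolding h(2) by (simp add: algebra_simps)
  qed
qed

end

section \<open>The threshold and the stopping time\<close>

lemma hfun_strict_mono:
  assumes "1 \<le> u" "u < v"
  shows "hfun u < hfun v"
proof -
  have "ln (v / u) < v / u - 1"
    using ln_le_minus_one[of "v / u"] ln_eq_minus_one[of "v / u"] assms by fastforce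
  also have "\<dots> = (v - u) / u" using assms by (simp add: diff_divide_distrib)
  also have "\<dots> \<le> v - u" using assms by (simp add: pos_divide_le_eq mult_le_cancel_left1)
  finally show ?thesis using assms by (simp add: hfun_def ln_div)
qed

lemma hinv_props:
  assumes "1 \<le> x"
  shows "1 \<le> hinv x" "hfun (hinv x) = x"
proof -
  \<comment> \<open>The bracket ends at 2 * x because ln 2 \<le> 1 and ln x \<le> x - 1 together
    give ln (2 * x) \<le> x.\<close>
  have "\<exists>u. 1 \<le> u \<and> u \<le> 2 * x \<and> hfun u = x"
  proof (rule IVT')
    show "hfun 1 \<le> x" using assms by (simp add: hfun_def)
    have "ln (2 * x) = ln 2 + ln x" using assms by (simp add: ln_mult)
    moreover have "ln x \<le> x - 1" "ln (2::real) \<le> 1" using ln_le_minus_one[of x] ln_le_minus_one[of 2] assms by auto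
    ultimately show "x \<le> hfun (2 * x)" using assms by (simp add: hfun_def)
    show "continuous_on {1..2 * x} hfun"
      unfolding hfun_def[abs_def] by (intro continuous_intros) auto
  qed (use assms in auto)
  then obtain u where u: "1 \<le> u" "hfun u = x" by blast
  have "hinv x = u" unfolding hinv_def
  proof (rule the_equality)
    show "v = u" if "1 \<le> v \<and> hfun v = x" for v
    proof (rule ccontr)
      assume "v \<noteq> u"
      then consider "u < v" | "v < u" by linarith
      then show False using that u hfun_strict_mono[of u v] hfun_strict_mono[of v u] by cases auto
    qed
  qed (use u in auto)
  then show "1 \<le> hinv x" "hfun (hinv x) = x" using u by auto
qed

lemma hinv_ge:
  assumes "1 \<le> x"
  shows "x \<le> hinv x"
proof -
  have "0 \<le> ln (hinv x)" by (rule ln_ge_zero[OF hinv_props(1)[OF assms]])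
  then show ?thesis using hinv_props(2)[OF assms] unfolding hfun_def by linarith
qed

lemma filterlim_hinv: "filterlim hinv at_top at_top"
  by (rule filterlim_at_top_mono[OF filterlim_ident])
    (use eventually_ge_at_top[of 1] in \<open>eventually_elim, auto intro: hinv_ge\<close>)

text \<open>Substitute u = \<open>hinv x\<close> in the limit of hfun u / u and take
  reciprocals.\<close>

lemma hinv_asymp: "((\<lambda>x. hinv x / x) \<longlongrightarrow> 1) at_top"
proof -
  have "((\<lambda>u::real. hfun u / u) \<longlongrightarrow> 1) at_top" unfolding hfun_def by real_asymp
  then have "((\<lambda>x. hfun (hinv x) / hinv x) \<longlongrightarrow> 1) at_top"
    by (rule filterlim_compose) (rule filterlim_hinv)
  then have "((\<lambda>x. inverse (hfun (hinv x) / hinv x)) \<longlongrightarrow> inverse 1) at_top"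
    by (rule tendsto_inverse) simp
  moreover have "\<forall>\<^sub>F x in at_top. inverse (hfun (hinv x) / hinv x) = hinv x / x"
    using eventually_ge_at_top[of 1] by eventually_elim (simp add: hinv_props)
  ultimately show ?thesis using Lim_transform_eventually by fastforce
qed

text \<open>For large \<open>x\<close> the first branch is in force, and its exponential factor
  tends to exp 0.\<close>

lemma htilde_asymp: "((\<lambda>x. htilde z x / x) \<longlongrightarrow> 1) at_top"
proof -
  have "((\<lambda>x. inverse (hinv x)) \<longlongrightarrow> 0) at_top"
    by (rule tendsto_inverse_0_at_top[OF filterlim_hinv])
  then have "((\<lambda>x. exp (inverse (hinv x)) * (hinv x / x)) \<longlongrightarrow> exp 0 * 1) at_top"
    by (intro tendsto_mult tendsto_exp hinv_asymp)
  moreover have "\<forall>\<^sub>F x in at_top. exp (inverse (hinv x)) * (hinv x / x) = htilde z x / x"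
    using eventually_ge_at_top[of "hinv (1 / ln z)"]
    by eventually_elim (simp add: htilde_def inverse_eq_divide)
  ultimately have "((\<lambda>x. htilde z x / x) \<longlongrightarrow> exp 0 * 1) at_top"
    by (rule Lim_transform_eventually)
  then show ?thesis by simp
qed

text \<open>The outer factor 2 cancels the inner division by 2, and the shifts by 1 and by the
  logarithm vanish relative to \<open>x\<close>. This is the source of the leading constant 1 in the
  threshold.\<close>

lemma Cexp_asymp: "((\<lambda>x. Cexp x / x) \<longlongrightarrow> 1) at_top"
proof -
  define c :: real where "c = ln (2 * (pi\<^sup>2 / 6))"
  define g where "g x = (hinv (1 + x) + c) / 2" for x
  have shift: "filterlim (\<lambda>x::real. 1 + x) at_top at_top" by real_asymp
  have h: "filterlim (\<lambda>x. hinv (1 + x)) at_top at_top"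
    by (rule filterlim_compose[OF filterlim_hinv shift])
  then have "filterlim (\<lambda>x. c + hinv (1 + x)) at_top at_top"
    by (rule filterlim_tendsto_add_at_top[OF tendsto_const])
  then have "filterlim (\<lambda>x. 1 / 2 * (c + hinv (1 + x))) at_top at_top"
    by (rule filterlim_tendsto_pos_mult_at_top[OF tendsto_const, rotated]) simp
  then have G: "filterlim g at_top at_top" by (simp add: g_def[abs_def] add.commute)
  have "((\<lambda>x. hinv (1 + x) / (1 + x)) \<longlongrightarrow> 1) at_top"
    by (rule filterlim_compose[OF hinv_asymp shift])
  moreover have "((\<lambda>x::real. (1 + x) / x) \<longlongrightarrow> 1) at_top" "((\<lambda>x::real. c / x) \<longlongrightarrow> 0) at_top"
    by real_asymp+
  ultimately have "((\<lambda>x. 2 * (htilde (3/2) (g x) / g x) * ((hinv (1 + x) / (1 + x) * ((1 + x) / x) + c / x) / 2))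
      \<longlongrightarrow> 2 * 1 * ((1 * 1 + 0) / 2)) at_top"
    using filterlim_compose[OF htilde_asymp G, of "3/2"] by (intro tendsto_intros) auto
  moreover have "\<forall>\<^sub>F x in at_top. 2 * (htilde (3/2) (g x) / g x) * ((hinv (1 + x) / (1 + x) * ((1 + x) / x) + c / x) / 2)
      = Cexp x / x"
    using eventually_gt_at_top[of 0] filterlim_at_top_dense[THEN iffD1, OF G, rule_format, of 0]
  proof eventually_elim
    case (elim x)
    have "A / y * (y / x) = A / x" if "y \<noteq> 0" for A y using that by simp
    from this[of "1 + x" "hinv (1 + x)"]
    have "hinv (1 + x) / (1 + x) * ((1 + x) / x) = hinv (1 + x) / x" using elim by linarith
    then have "(hinv (1 + x) / (1 + x) * ((1 + x) / x) + c / x) / 2 = g x / x"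
      by (simp only: g_def add_divide_distrib) simp
    moreover have "Cexp x = 2 * htilde (3/2) (g x)" unfolding Cexp_def g_def c_def ..
    ultimately show ?case using elim by simp
  qed
  ultimately have "((\<lambda>x. Cexp x / x) \<longlongrightarrow> 2 * 1 * ((1 * 1 + 0) / 2)) at_top"
    by (rule Lim_transform_eventually)
  then show ?thesis by simp
qed

section \<open>From sufficient conditions for stopping to bounds on the stopping time\<close>

text \<open>Rational bounds are used so that countably many almost sure statements can be combined;
  an infinite \<open>T\<close> is covered trivially.\<close>

lemma ereal_le_of_rat:
  fixes L T :: ereal
  assumes "\<And>r::rat. T < ereal (of_rat r) \<Longrightarrow> L \<le> ereal (of_rat r)"
  shows "L \<le> T"
proof (rule ccontr)
  assume "\<not> L \<le> T"
  then have "T < L" by (simp only: not_le)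
  from ereal_dense3[OF this] obtain r :: rat where "T < ereal (of_rat r)" "ereal (of_rat r) < L"
    by blast
  then show False using assms[of r] by simp
qed

lemma tau_le: "stop_cond F \<delta> \<omega> t \<Longrightarrow> tau F \<delta> \<omega> \<le> enat t"
  unfolding tau_def by (auto intro: Least_le)

text \<open>The first integer beyond both times exceeds their sum by at most 1.\<close>

lemma tau_bound:
  assumes "0 \<le> T" "\<And>t. M \<le> of_nat t \<Longrightarrow> T \<le> real t \<Longrightarrow> stop_cond F \<delta> \<omega> t"
  shows "ennreal_of_enat (tau F \<delta> \<omega>) \<le> M + ennreal (T + 1)"
proof (cases M)
  case (real b)
  define t where "t = nat \<lceil>max b T\<rceil>"
  have t: "b \<le> real t" "T \<le> real t" "real t \<le> b + (T + 1)"
    unfolding t_def using real assms(1) by linarith+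
  have "M \<le> of_nat t" using t(1) real by (simp add: ennreal_of_nat_eq_real_of_nat)
  then have "tau F \<delta> \<omega> \<le> enat t" using t(2) by (intro tau_le assms(2))
  then have "ennreal_of_enat (tau F \<delta> \<omega>) \<le> ennreal (real t)"
    by (metis ennreal_of_enat_enat ennreal_of_enat_le_iff ennreal_of_nat_eq_real_of_nat)
  also have "\<dots> \<le> ennreal (b + (T + 1))" using t(3) by (rule ennreal_leI)
  also have "\<dots> = M + ennreal (T + 1)" using real assms(1) by (simp add: ennreal_plus[symmetric] del: ennreal_plus)
  finally show ?thesis .
qed (simp add: top_unique)

context ftas
begin

definition D :: "real \<Rightarrow> real" where
  "D \<delta> = real CARD('k) * Cexp (ln (1 / \<delta>) / real CARD('k))"

lemma D_asymp: "((\<lambda>\<delta>. D \<delta> / ln (1 / \<delta>)) \<longlongrightarrow> 1) (at_right 0)"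
proof -
  have K: "0 < real CARD('k)" by simp
  have "filterlim (\<lambda>\<delta>::real. ln (1 / \<delta>)) at_top (at_right 0)" by real_asymp
  then have "filterlim (\<lambda>\<delta>::real. (1 / real CARD('k)) * ln (1 / \<delta>)) at_top (at_right 0)"
    using K by (intro filterlim_tendsto_pos_mult_at_top[OF tendsto_const]) auto
  then have "((\<lambda>\<delta>. Cexp ((1 / real CARD('k)) * ln (1 / \<delta>)) / ((1 / real CARD('k)) * ln (1 / \<delta>))) \<longlongrightarrow> 1) (at_right 0)"
    by (rule filterlim_compose[OF Cexp_asymp])
  then show ?thesis by (simp add: D_def mult.commute)
qed

lemma N_le: "N \<omega> t a \<le> t"
proof (induction t)
  case (Suc t)
  have "N \<omega> (Suc t) a = N \<omega> t a + (if arm \<omega> t = a then 1 else 0)" by (simp add: Let_def)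
  then show ?case using Suc by (simp del: state.simps)
qed simp

lemma thresh_le:
  assumes "\<And>a. 0 < N \<omega> t a"
  shows "thresh \<delta> (fst (state F \<omega> t)) \<le> 3 * real CARD('k) * ln (1 + ln (real t)) + D \<delta>"
proof -
  have "(\<Sum>a\<in>UNIV. ln (1 + ln (real (N \<omega> t a)))) \<le> (\<Sum>a\<in>(UNIV::'k set). ln (1 + ln (real t)))"
  proof (rule sum_mono)
    fix a
    have n: "1 \<le> real (N \<omega> t a)" "real (N \<omega> t a) \<le> real t"
      using assms[of a] N_le[of \<omega> t a] by (auto simp: Suc_le_eq)
    then have "0 \<le> ln (real (N \<omega> t a))" "ln (real (N \<omega> t a)) \<le> ln (real t)" by auto
    then show "ln (1 + ln (real (N \<omega> t a))) \<le> ln (1 + ln (real t))" by simp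
  qed
  then show ?thesis by (simp add: thresh_def D_def)
qed

abbreviation "best \<equiv> best_arm theta"

lemma best_arm_near:
  assumes "\<And>a. \<bar>lam$a - theta$a\<bar> < e" "\<And>a. a \<noteq> best \<Longrightarrow> 2 * e \<le> gap theta a"
  shows "best_arm lam = best"
    and "\<And>a. gap theta a - 2 * e \<le> lam$best - lam$a"
proof -
  show g: "gap theta a - 2 * e \<le> lam$best - lam$a" for a
    using assms(1)[of a] assms(1)[of best] by (simp add: gap_def abs_less_iff)
  show "best_arm lam = best"
  proof (rule best_armI)
    fix b assume "b \<noteq> best"
    then show "lam$b < lam$best"
      using assms(1)[of b] assms(1)[of best] assms(2)[of b] by (auto simp: gap_def abs_less_iff)
  qed
qed

text \<open>The statistic increases with the counts and with the gaps, so lower bounds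
  \<open>n\<close> on the counts suffice. They will be of order sqrt t for finiteness and of order t
  for the sharp bound.\<close>

lemma stop_condI:
  assumes pos: "\<And>a. 0 < N \<omega> t a"
    and near: "\<And>a. \<bar>emp_mean (state F \<omega> t)$a - theta$a\<bar> < e" "\<And>a. a \<noteq> best \<Longrightarrow> 2 * e \<le> gap theta a"
    and n: "\<And>a. 0 < n a" "\<And>a. n a \<le> real (N \<omega> t a)"
    and V: "\<And>a. a \<noteq> best \<Longrightarrow> V \<le> (gap theta a - 2 * e)\<^sup>2 / (2 * (1 / n a + 1 / n best))"
    and D: "3 * real CARD('k) * ln (1 + ln (real t)) + D \<delta> \<le> V"
  shows "stop_cond F \<delta> \<omega> t"
proof -
  define lam where "lam = emp_mean (state F \<omega> t)"
  have b: "best_arm lam = best" and g: "gap theta a - 2 * e \<le> lam$best - lam$a" for a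
    using best_arm_near[of lam e] near unfolding lam_def by blast+
  have "V \<le> (lam$best - lam$a)\<^sup>2 / (2 * (1 / real (N \<omega> t a) + 1 / real (N \<omega> t best)))" if "a \<noteq> best" for a
  proof -
    have "V \<le> (gap theta a - 2 * e)\<^sup>2 / (2 * (1 / n a + 1 / n best))" by (rule V[OF that])
    also have "\<dots> \<le> (lam$best - lam$a)\<^sup>2 / (2 * (1 / real (N \<omega> t a) + 1 / real (N \<omega> t best)))"
    proof (rule frac_le)
      show "(gap theta a - 2 * e)\<^sup>2 \<le> (lam$best - lam$a)\<^sup>2"
        using near(2)[OF that] g[of a] by (intro power_mono) auto
      have N0: "0 < real (N \<omega> t a)" "0 < real (N \<omega> t best)" using pos by auto
      then show "0 < 2 * (1 / real (N \<omega> t a) + 1 / real (N \<omega> t best))"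
        by (intro mult_pos_pos add_pos_pos divide_pos_pos) auto
      show "2 * (1 / real (N \<omega> t a) + 1 / real (N \<omega> t best)) \<le> 2 * (1 / n a + 1 / n best)"
        using n by (intro mult_left_mono add_mono divide_left_mono mult_pos_pos N0) auto
    qed simp
    finally show ?thesis .
  qed
  then have "V \<le> Zstat (state F \<omega> t)"
    unfolding Zstat_def Let_def lam_def[symmetric] b
    using other_arms[of best] by (subst Min_ge_iff) auto
  moreover have "thresh \<delta> (fst (state F \<omega> t)) \<le> V" using thresh_le[OF pos] D by (rule order_trans)
  ultimately show ?thesis unfolding stop_cond_def Let_def using pos by (auto simp: Suc_le_eq)
qed

text \<open>With the factor 4, an estimation error of \<open>e\<close> in each mean still leaves
  empirical gaps of at least 2 * e.\<close>

lemma gap_margin: obtains e where "0 < e" "\<And>a. a \<noteq> best \<Longrightarrow> 4 * e \<le> gap theta a"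
proof
  define e where "e = Min (gap theta ` {a. a \<noteq> best}) / 4"
  have "0 < Min (gap theta ` {a. a \<noteq> best})"
    using other_arms[of best] gap_pos[OF uniq] by (subst Min_gr_iff) auto
  then show "0 < e" by (simp add: e_def)
  show "4 * e \<le> gap theta a" if "a \<noteq> best" for a
    using Min_le[of "gap theta ` {a. a \<noteq> best}" "gap theta a"] that by (auto simp: e_def)
qed

lemma tau_expectation_finite: "(\<integral>\<^sup>+\<omega>. ennreal_of_enat (tau F \<delta> \<omega>) \<partial>traj_meas theta) < \<infinity>"
proof -
  interpret P: prob_space "traj_meas theta" by (rule prob_space_traj)
  obtain e where e: "0 < e" "\<And>a. a \<noteq> best \<Longrightarrow> 4 * e \<le> gap theta a" using gap_margin by blast
  obtain M where M: "M \<in> borel_measurable (traj_meas theta)" "(\<integral>\<^sup>+\<omega>. M \<omega> \<partial>traj_meas theta) < \<infinity>"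
    "\<And>\<omega> t a. M \<omega> \<le> of_nat t \<Longrightarrow> 0 < N \<omega> t a"
    "\<And>\<omega> t a. M \<omega> \<le> of_nat t \<Longrightarrow> pmin / 8 * sqrt (real t) \<le> real (N \<omega> t a)"
    "\<And>\<omega> t a. M \<omega> \<le> of_nat t \<Longrightarrow> \<bar>emp_mean (state F \<omega> t)$a - theta$a\<bar> < e"
    using concentration[OF e(1)] by metis
  \<comment> \<open>With gaps 2 * e and all counts equal to n = pmin / 8 * sqrt t, the statistic is
    (2 * e)^2 / (2 * (2 / n)) = e^2 * n = c * sqrt t.\<close>
  define c where "c = e\<^sup>2 * (pmin / 8)"
  have c: "0 < c" using e(1) pmin_pos by (simp add: c_def)
  have "((\<lambda>x::real. 3 * real CARD('k) * (ln (1 + ln x) / sqrt x) + D \<delta> * (1 / sqrt x)) \<longlongrightarrow>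
      3 * real CARD('k) * 0 + D \<delta> * 0) at_top"
    by (intro tendsto_add tendsto_mult tendsto_const) real_asymp+
  then have "\<forall>\<^sub>F x in at_top. 3 * real CARD('k) * (ln (1 + ln x) / sqrt x) + D \<delta> * (1 / sqrt x) < c"
    using c by (intro order_tendstoD) auto
  then obtain T where T: "\<And>x. T \<le> x \<Longrightarrow> 3 * real CARD('k) * (ln (1 + ln x) / sqrt x) + D \<delta> * (1 / sqrt x) < c"
    unfolding eventually_at_top_linorder by blast
  have "ennreal_of_enat (tau F \<delta> \<omega>) \<le> M \<omega> + ennreal (max 1 T + 1)" for \<omega>
  proof (rule tau_bound)
    fix t assume t: "M \<omega> \<le> of_nat t" "max 1 T \<le> real t"
    define n where "n = pmin / 8 * sqrt (real t)"
    have n: "0 < n" using pmin_pos t(2) by (simp add: n_def)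
    show "stop_cond F \<delta> \<omega> t"
    proof (rule stop_condI)
      show "2 * e \<le> gap theta a" if "a \<noteq> best" for a using e(1) e(2)[OF that] by simp
      show "c * sqrt (real t) \<le> (gap theta a - 2 * e)\<^sup>2 / (2 * (1 / n + 1 / n))" if "a \<noteq> best" for a
      proof -
        have "c * sqrt (real t) = (2 * e)\<^sup>2 / (2 * (1 / n + 1 / n))"
          using n by (simp add: c_def n_def power2_eq_square)
        also have "\<dots> \<le> (gap theta a - 2 * e)\<^sup>2 / (2 * (1 / n + 1 / n))"
          using e(1) e(2)[OF that] n by (intro divide_right_mono power_mono) auto
        finally show ?thesis .
      qed
      have s: "0 < sqrt (real t)" using t(2) by simp
      have "(3 * real CARD('k) * (ln (1 + ln (real t)) / sqrt (real t)) + D \<delta> * (1 / sqrt (real t))) * sqrt (real t)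
          \<le> c * sqrt (real t)"
        using T[of "real t"] t(2) s by (intro mult_right_mono) auto
      moreover have "(3 * real CARD('k) * (ln (1 + ln (real t)) / sqrt (real t)) + D \<delta> * (1 / sqrt (real t))) * sqrt (real t)
          = 3 * real CARD('k) * ln (1 + ln (real t)) + D \<delta>"
        using s by (simp add: distrib_right)
      ultimately show "3 * real CARD('k) * ln (1 + ln (real t)) + D \<delta> \<le> c * sqrt (real t)" by simp
    qed (use M(3-5)[OF t(1)] n in \<open>auto simp: n_def\<close>)
  qed simp
  then have "(\<integral>\<^sup>+\<omega>. ennreal_of_enat (tau F \<delta> \<omega>) \<partial>traj_meas theta)
      \<le> (\<integral>\<^sup>+\<omega>. M \<omega> + ennreal (max 1 T + 1) \<partial>traj_meas theta)"
    by (intro nn_integral_mono)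
  also have "\<dots> = (\<integral>\<^sup>+\<omega>. M \<omega> \<partial>traj_meas theta) + ennreal (max 1 T + 1)"
    using M(1) by (simp add: nn_integral_add P.emeasure_space_1)
  also have "\<dots> < \<infinity>" using M(2) by (simp add: less_top[symmetric])
  finally show ?thesis .
qed

section \<open>The sharp bound on the stopping time\<close>

text \<open>A finite value forces positive optimal utility, hence full support. The last claim says
  that with exact means and exact proportions the statistic grows faster than t / V.\<close>

lemma Tstar_less_imp:
  assumes "Tstar (rate F theta) theta < ereal V"
  shows "0 < V" and "\<And>a. 0 < wstar F theta$a"
    and "\<And>a. a \<noteq> best \<Longrightarrow> V / 2 > (1 / wstar F theta$a + 1 / wstar F theta$best) / (gap theta a)\<^sup>2"
proof -
  define w where "w = wstar F theta"
  have w0: "0 \<le> w$a" for a unfolding w_def by (rule Sigma_p_nonneg[OF wstar_in_simplex])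
  define u where "u = util theta w"
  have lt: "2 * einv u < ereal V"
    using assms unfolding Tstar_eq_obj_wstar[OF uniq valid] w_def[symmetric] obj_eq_einv_util[OF uniq w0] u_def .
  have u0: "0 \<le> u" unfolding u_def by (intro util_nonneg w0)
  moreover have "u \<noteq> 0" using lt by (auto simp: einv_def)
  ultimately have u: "0 < u" by simp
  then have V: "2 / u < V" using lt by (simp add: einv_def)
  have "0 < 2 / u" using u by simp
  then show "0 < V" using V by linarith
  show wp: "0 < wstar F theta$a" for a
    using util_pos_iff[OF uniq w0] u unfolding u_def w_def[symmetric] by blast
  show "V / 2 > (1 / wstar F theta$a + 1 / wstar F theta$best) / (gap theta a)\<^sup>2" if a: "a \<noteq> best" for a
  proof -
    have g: "0 < (gap theta a)\<^sup>2" using gap_pos[OF uniq a] by simp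
    have "u \<le> (gap theta a)\<^sup>2 * hmean (w$a) (w$best)"
      using le_util_iff[of u theta w] a by (simp add: u_def)
    then have "u / (gap theta a)\<^sup>2 \<le> hmean (w$a) (w$best)" using g by (simp add: pos_divide_le_eq mult.commute)
    then have "1 / w$a + 1 / w$best \<le> (gap theta a)\<^sup>2 / u"
      using le_hmean_iff[of "w$a" "w$best" "u / (gap theta a)\<^sup>2"] wp u g by (simp add: w_def)
    then have "(1 / w$a + 1 / w$best) / (gap theta a)\<^sup>2 \<le> 1 / u" using g by (simp add: pos_divide_le_eq)
    also have "\<dots> < V / 2" using V by simp
    finally show ?thesis unfolding w_def .
  qed
qed

text \<open>\<open>M\<close> and \<open>T\<close> are chosen before \<delta>, so one estimate serves
  almost every path and the expectation. The absolute value of \<open>D \<delta>\<close> avoids any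
  restriction on \<delta>.\<close>

lemma tau_refined_bound:
  assumes "Tstar (rate F theta) theta < ereal V'"
  obtains M T where "M \<in> borel_measurable (traj_meas theta)" "(\<integral>\<^sup>+\<omega>. M \<omega> \<partial>traj_meas theta) < \<infinity>" "0 \<le> T"
    "\<And>\<delta> \<omega>. ennreal_of_enat (tau F \<delta> \<omega>) \<le> M \<omega> + ennreal (T + V' * \<bar>D \<delta>\<bar> + 1)"
proof -
  \<comment> \<open>Two margins: the one between \<open>Tstar\<close> and \<open>V\<close> absorbs
    the errors in means and weights, the one between \<open>V\<close> and \<open>V'\<close> absorbs
    the doubly logarithmic part of the threshold.\<close>
  obtain V where V: "Tstar (rate F theta) theta < ereal V" "V < V'"
    using ereal_dense2[OF assms] by auto
  note V0 = Tstar_less_imp(1)[OF V(1)] and wp = Tstar_less_imp(2)[OF V(1)]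
  define w where "w = wstar F theta"
  have wpos: "0 < w$a" for a using wp by (simp add: w_def)
  define good where "good a e \<longleftrightarrow> 0 < w$a - e \<and> (a \<noteq> best \<longrightarrow> 0 < gap theta a - 2 * e \<and>
      (1 / (w$a - e) + 1 / (w$best - e)) / (gap theta a - 2 * e)\<^sup>2 < V / 2)" for a e
  have "\<forall>\<^sub>F e in at_right 0. good a e" for a
  proof -
    have lw: "((\<lambda>e. w$b - e) \<longlongrightarrow> w$b - 0) (at_right 0)" for b by (intro tendsto_intros)
    have "\<forall>\<^sub>F e in at_right 0. 0 < w$a - e"
      using order_tendstoD(1)[OF lw, of 0 a] wpos[of a] by simp
    moreover have "\<forall>\<^sub>F e in at_right 0. a \<noteq> best \<longrightarrow> 0 < gap theta a - 2 * e \<and>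
      (1 / (w$a - e) + 1 / (w$best - e)) / (gap theta a - 2 * e)\<^sup>2 < V / 2"
    proof (cases "a = best")
      case False
      have g: "0 < gap theta a" by (rule gap_pos[OF uniq False])
      have lg: "((\<lambda>e. gap theta a - 2 * e) \<longlongrightarrow> gap theta a - 2 * 0) (at_right 0)" by (intro tendsto_intros)
      have "((\<lambda>e. (1 / (w$a - e) + 1 / (w$best - e)) / (gap theta a - 2 * e)\<^sup>2) \<longlongrightarrow>
          (1 / (w$a - 0) + 1 / (w$best - 0)) / (gap theta a - 2 * 0)\<^sup>2) (at_right 0)"
        using wpos[of a] wpos[of best] g by (intro tendsto_divide tendsto_add tendsto_power tendsto_const lw lg) auto
      then have "\<forall>\<^sub>F e in at_right 0. (1 / (w$a - e) + 1 / (w$best - e)) / (gap theta a - 2 * e)\<^sup>2 < V / 2"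
        using Tstar_less_imp(3)[OF V(1) False] by (intro order_tendstoD(2)) (auto simp: w_def)
      moreover have "\<forall>\<^sub>F e in at_right 0. 0 < gap theta a - 2 * e"
        using order_tendstoD(1)[OF lg, of 0] g by simp
      ultimately show ?thesis by eventually_elim simp
    qed simp
    ultimately show ?thesis unfolding good_def by eventually_elim blast
  qed
  then have "\<forall>\<^sub>F e in at_right 0. \<forall>a. good a e" by (rule eventually_all_finite)
  moreover have "\<forall>\<^sub>F e in at_right (0::real). 0 < e" by (rule eventually_at_right_less)
  ultimately have "\<forall>\<^sub>F e in at_right 0. 0 < e \<and> (\<forall>a. good a e)" by eventually_elim blast
  then obtain e where e: "0 < e" "\<And>a. good a e"
    using eventually_happens'[OF trivial_limit_at_right_real] by blast
  obtain M where M: "M \<in> borel_measurable (traj_meas theta)" "(\<integral>\<^sup>+\<omega>. M \<omega> \<partial>traj_meas theta) < \<infinity>"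
    "\<And>\<omega> t a. M \<omega> \<le> of_nat t \<Longrightarrow> 0 < N \<omega> t a"
    "\<And>\<omega> t a. M \<omega> \<le> of_nat t \<Longrightarrow> \<bar>emp_mean (state F \<omega> t)$a - theta$a\<bar> < e"
    "\<And>\<omega> t a. M \<omega> \<le> of_nat t \<Longrightarrow> real t * (wstar F theta$a - e) \<le> real (N \<omega> t a)"
    using concentration[OF e(1)] by metis
  \<comment> \<open>The slope left for the logarithmic term once t / V' is reserved for
    \<open>D \<delta>\<close>.\<close>
  define c where "c = 1 / V - 1 / V'"
  have c: "0 < c" using V(2) V0 by (simp add: c_def divide_strict_left_mono)
  have "((\<lambda>x::real. 3 * real CARD('k) * (ln (1 + ln x) / x)) \<longlongrightarrow> 3 * real CARD('k) * 0) at_top"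
    by (intro tendsto_mult tendsto_const) real_asymp
  then have "\<forall>\<^sub>F x in at_top. 3 * real CARD('k) * (ln (1 + ln x) / x) < c"
    using c by (intro order_tendstoD) auto
  then obtain T where T: "\<And>x. T \<le> x \<Longrightarrow> 3 * real CARD('k) * (ln (1 + ln x) / x) < c"
    unfolding eventually_at_top_linorder by blast
  have V'0: "0 < V'" using V(2) V0 by simp
  show ?thesis
  proof (rule that[OF M(1,2)])
    show "0 \<le> max 1 T" by simp
    fix \<delta> \<omega>
    show "ennreal_of_enat (tau F \<delta> \<omega>) \<le> M \<omega> + ennreal (max 1 T + V' * \<bar>D \<delta>\<bar> + 1)"
    proof (rule tau_bound)
      show "0 \<le> max 1 T + V' * \<bar>D \<delta>\<bar>" using V'0 by simp
      fix t assume t: "M \<omega> \<le> of_nat t" "max 1 T + V' * \<bar>D \<delta>\<bar> \<le> real t"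
      have "0 \<le> V' * \<bar>D \<delta>\<bar>" using V'0 by simp
      then have t1: "1 \<le> real t" "T \<le> real t" "V' * \<bar>D \<delta>\<bar> \<le> real t" using t(2) by linarith+
      show "stop_cond F \<delta> \<omega> t"
      proof (rule stop_condI)
        show "0 < N \<omega> t a" for a by (rule M(3)[OF t(1)])
        show "\<bar>emp_mean (state F \<omega> t)$a - theta$a\<bar> < e" for a by (rule M(4)[OF t(1)])
        show "2 * e \<le> gap theta a" if "a \<noteq> best" for a using e(2)[of a] that by (simp add: good_def)
        show "real t * (w$a - e) \<le> real (N \<omega> t a)" for a unfolding w_def by (rule M(5)[OF t(1)])
        show "0 < real t * (w$a - e)" for a
          using e(2)[of a] t1(1) by (intro mult_pos_pos) (auto simp: good_def)
        show "real t / V \<le> (gap theta a - 2 * e)\<^sup>2 / (2 * (1 / (real t * (w$a - e)) + 1 / (real t * (w$best - e))))"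
          if a: "a \<noteq> best" for a
        proof -
          define A where "A = 1 / (w$a - e) + 1 / (w$best - e)"
          define G where "G = (gap theta a - 2 * e)\<^sup>2"
          have G: "0 < G" using e(2)[of a] a by (simp add: G_def good_def)
          have A: "0 < A" using e(2)[of a] e(2)[of best] by (auto simp: A_def good_def intro!: add_pos_pos)
          have "A / G < V / 2" using e(2)[of a] a by (simp add: good_def A_def G_def)
          then have "2 * A < V * G" using G by (simp add: pos_divide_less_eq)
          then have "real t * (2 * A) \<le> real t * (V * G)" by (intro mult_left_mono) auto
          then have "real t / V \<le> real t * G / (2 * A)"
            using A V0 by (simp add: pos_divide_le_eq pos_le_divide_eq mult_ac)
          also have "\<dots> = G / (2 * (A / real t))" using t1(1) by simp
          also have "A / real t = 1 / (real t * (w$a - e)) + 1 / (real t * (w$best - e))"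
            by (simp add: A_def add_divide_distrib mult.commute)
          finally show ?thesis by (simp add: G_def)
        qed
        have "3 * real CARD('k) * ln (1 + ln (real t)) \<le> c * real t"
          using T[OF t1(2)] t1(1) by (simp add: pos_divide_less_eq less_imp_le)
        moreover have "\<bar>D \<delta>\<bar> \<le> real t / V'"
          using t1(3) V'0 by (simp add: pos_le_divide_eq mult.commute)
        moreover have "c * real t = real t / V - real t / V'" by (simp add: c_def left_diff_distrib)
        ultimately show "3 * real CARD('k) * ln (1 + ln (real t)) + D \<delta> \<le> real t / V" by linarith
      qed
    qed
  qed
qed

section \<open>Passage to the limit\<close>

text \<open>Stated for a general \<open>f\<close> because it is applied both to single paths and to
  the expectation: a constant \<open>b\<close>, even one depending on the path, disappears after
  division by ln (1 / \<delta>).\<close>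

lemma Limsup_le_of_bound:
  assumes "\<And>\<delta>. f \<delta> \<le> ennreal (b + V' * \<bar>D \<delta>\<bar>)" "0 \<le> b" "0 \<le> V'"
  shows "Limsup (at_right 0) (\<lambda>\<delta>. enn2ereal (f \<delta>) / ereal (ln (1 / \<delta>))) \<le> ereal V'"
proof -
  define g where "g \<delta> = b * (1 / ln (1 / \<delta>)) + V' * \<bar>D \<delta> / ln (1 / \<delta>)\<bar>" for \<delta>
  have "((\<lambda>\<delta>::real. 1 / ln (1 / \<delta>)) \<longlongrightarrow> 0) (at_right 0)" by real_asymp
  then have "(g \<longlongrightarrow> b * 0 + V' * \<bar>1\<bar>) (at_right 0)"
    unfolding g_def by (intro tendsto_intros D_asymp)
  then have "((\<lambda>\<delta>. ereal (g \<delta>)) \<longlongrightarrow> ereal V') (at_right 0)" by simp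
  then have L: "Limsup (at_right 0) (\<lambda>\<delta>. ereal (g \<delta>)) = ereal V'"
    by (intro lim_imp_Limsup) auto
  have "\<forall>\<^sub>F \<delta> in at_right (0::real). \<delta> < 1" "\<forall>\<^sub>F \<delta> in at_right (0::real). 0 < \<delta>"
    by (auto intro: eventually_at_right_less order_tendstoD(2)[OF tendsto_ident_at])
  then have "\<forall>\<^sub>F \<delta> in at_right 0. enn2ereal (f \<delta>) / ereal (ln (1 / \<delta>)) \<le> ereal (g \<delta>)"
  proof eventually_elim
    case (elim \<delta>)
    then have l: "0 < ln (1 / \<delta>)" by simp
    have "enn2ereal (f \<delta>) \<le> enn2ereal (ennreal (b + V' * \<bar>D \<delta>\<bar>))"
      using assms(1) by (simp add: less_eq_ennreal.rep_eq[symmetric])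
    also have "\<dots> = ereal (b + V' * \<bar>D \<delta>\<bar>)" using assms(2,3) by (intro enn2ereal_ennreal) simp
    finally have "enn2ereal (f \<delta>) / ereal (ln (1 / \<delta>)) \<le> ereal (b + V' * \<bar>D \<delta>\<bar>) / ereal (ln (1 / \<delta>))"
      using l by (intro ereal_divide_right_mono) auto
    also have "\<dots> = ereal (g \<delta>)" using l by (simp add: g_def add_divide_distrib abs_divide)
    finally show ?case .
  qed
  then show ?thesis using Limsup_mono[of _ "\<lambda>\<delta>. ereal (g \<delta>)"] L by metis
qed

lemma Limsup_tau_AE:
  assumes "Tstar (rate F theta) theta < ereal V'"
  shows "AE \<omega> in traj_meas theta.
    Limsup (at_right 0) (\<lambda>\<delta>. ereal_of_enat (tau F \<delta> \<omega>) / ereal (ln (1 / \<delta>))) \<le> ereal V'"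
proof -
  obtain M T where M: "M \<in> borel_measurable (traj_meas theta)" "(\<integral>\<^sup>+\<omega>. M \<omega> \<partial>traj_meas theta) < \<infinity>" "0 \<le> T"
    "\<And>\<delta> \<omega>. ennreal_of_enat (tau F \<delta> \<omega>) \<le> M \<omega> + ennreal (T + V' * \<bar>D \<delta>\<bar> + 1)"
    using tau_refined_bound[OF assms] by blast
  have V': "0 \<le> V'" using Tstar_less_imp(1)[OF assms] by simp
  have "AE \<omega> in traj_meas theta. M \<omega> \<noteq> \<infinity>"
    using M(1,2) by (intro nn_integral_PInf_AE) auto
  then show ?thesis
  proof eventually_elim
    case (elim \<omega>)
    then obtain b where b: "M \<omega> = ennreal b" "0 \<le> b" by (cases "M \<omega>") auto
    have "ennreal_of_enat (tau F \<delta> \<omega>) \<le> ennreal ((b + T + 1) + V' * \<bar>D \<delta>\<bar>)" for \<delta>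
      using M(4)[of \<delta> \<omega>] b M(3) V' by (simp add: ennreal_plus[symmetric] algebra_simps del: ennreal_plus)
    then have "Limsup (at_right 0) (\<lambda>\<delta>. enn2ereal (ennreal_of_enat (tau F \<delta> \<omega>)) / ereal (ln (1 / \<delta>))) \<le> ereal V'"
      by (rule Limsup_le_of_bound) (use b M(3) V' in auto)
    moreover have "enn2ereal (ennreal_of_enat n) = ereal_of_enat n" for n
      by (cases n) (auto simp: ennreal_of_nat_eq_real_of_nat)
    ultimately show ?case by simp
  qed
qed

lemma Limsup_tau_expectation:
  assumes "Tstar (rate F theta) theta < ereal V'"
  shows "Limsup (at_right 0) (\<lambda>\<delta>. enn2ereal (\<integral>\<^sup>+\<omega>. ennreal_of_enat (tau F \<delta> \<omega>) \<partial>traj_meas theta)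
    / ereal (ln (1 / \<delta>))) \<le> ereal V'"
proof -
  interpret P: prob_space "traj_meas theta" by (rule prob_space_traj)
  obtain M T where M: "M \<in> borel_measurable (traj_meas theta)" "(\<integral>\<^sup>+\<omega>. M \<omega> \<partial>traj_meas theta) < \<infinity>" "0 \<le> T"
    "\<And>\<delta> \<omega>. ennreal_of_enat (tau F \<delta> \<omega>) \<le> M \<omega> + ennreal (T + V' * \<bar>D \<delta>\<bar> + 1)"
    using tau_refined_bound[OF assms] by blast
  have V': "0 \<le> V'" using Tstar_less_imp(1)[OF assms] by simp
  obtain b where b: "(\<integral>\<^sup>+\<omega>. M \<omega> \<partial>traj_meas theta) = ennreal b" "0 \<le> b"
    using M(2) by (cases "\<integral>\<^sup>+\<omega>. M \<omega> \<partial>traj_meas theta") auto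
  have "(\<integral>\<^sup>+\<omega>. ennreal_of_enat (tau F \<delta> \<omega>) \<partial>traj_meas theta) \<le> ennreal ((b + T + 1) + V' * \<bar>D \<delta>\<bar>)" for \<delta>
  proof -
    have "(\<integral>\<^sup>+\<omega>. ennreal_of_enat (tau F \<delta> \<omega>) \<partial>traj_meas theta)
        \<le> (\<integral>\<^sup>+\<omega>. M \<omega> + ennreal (T + V' * \<bar>D \<delta>\<bar> + 1) \<partial>traj_meas theta)"
      by (intro nn_integral_mono M(4))
    also have "\<dots> = ennreal b + ennreal (T + V' * \<bar>D \<delta>\<bar> + 1)"
      using M(1) by (simp add: nn_integral_add P.emeasure_space_1 b)
    also have "\<dots> = ennreal ((b + T + 1) + V' * \<bar>D \<delta>\<bar>)"
      using b M(3) V' by (simp add: ennreal_plus[symmetric] algebra_simps del: ennreal_plus)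
    finally show ?thesis .
  qed
  then show ?thesis by (rule Limsup_le_of_bound) (use b M(3) V' in auto)
qed

lemma Limsup_tau_AE_Tstar:
  "AE \<omega> in traj_meas theta.
    Limsup (at_right 0) (\<lambda>\<delta>. ereal_of_enat (tau F \<delta> \<omega>) / ereal (ln (1 / \<delta>))) \<le> Tstar (rate F theta) theta"
proof -
  have "AE \<omega> in traj_meas theta. \<forall>r::rat. Tstar (rate F theta) theta < ereal (of_rat r) \<longrightarrow>
    Limsup (at_right 0) (\<lambda>\<delta>. ereal_of_enat (tau F \<delta> \<omega>) / ereal (ln (1 / \<delta>))) \<le> ereal (of_rat r)"
    unfolding AE_all_countable using Limsup_tau_AE by auto
  then show ?thesis by eventually_elim (rule ereal_le_of_rat, blast)
qed

lemma Limsup_tau_expectation_Tstar: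
  "Limsup (at_right 0) (\<lambda>\<delta>. enn2ereal (\<integral>\<^sup>+\<omega>. ennreal_of_enat (tau F \<delta> \<omega>) \<partial>traj_meas theta)
    / ereal (ln (1 / \<delta>))) \<le> Tstar (rate F theta) theta"
  by (rule ereal_le_of_rat) (rule Limsup_tau_expectation)

end

theorem theorem2:
  fixes F :: "('k::{finite,linorder}) fairness" and theta :: "(real, 'k) vec"
  assumes "card (UNIV :: 'k set) \<ge> 2"
    and "uniq_best theta"
    and "valid_fairness F"
    and "\<forall>p. F = Prespec p \<longrightarrow> (\<Sum>a\<in>UNIV. p$a) < 1 \<or> (\<forall>a. 0 < p$a)"
  shows "(\<forall>\<delta>. 0 < \<delta> \<and> \<delta> < 1/2 \<longrightarrow>
            (\<integral>\<^sup>+ \<omega>. ennreal_of_enat (tau F \<delta> \<omega>) \<partial>traj_meas theta) < \<infinity>)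
       \<and> (AE \<omega> in traj_meas theta.
            Limsup (at_right 0) (\<lambda>\<delta>. ereal_of_enat (tau F \<delta> \<omega>) / ereal (ln (1 / \<delta>)))
              \<le> Tstar (rate F theta) theta)
       \<and> Limsup (at_right 0)
            (\<lambda>\<delta>. enn2ereal (\<integral>\<^sup>+ \<omega>. ennreal_of_enat (tau F \<delta> \<omega>) \<partial>traj_meas theta) / ereal (ln (1 / \<delta>)))
           \<le> Tstar (rate F theta) theta"
proof -
  interpret ftas "TYPE('k)" F theta
    using assms by unfold_locales auto
  show ?thesis
    using tau_expectation_finite Limsup_tau_AE_Tstar Limsup_tau_expectation_Tstar by blast
qed

end
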